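(* Let $\alpha_0=-\log(\sqrt2-1)$, let $\nu\in\mathbb{N}=\{0,1,2,\dots\}$ and let $x>0$ be real. Let $\mathcal{L}(0,x)$ and $\mathcal{U}(0,x)$ be the explicit quantities defined in the context. (1) If $\nu\leq x$, then $$\frac{\exp\left(-\frac{\nu(\nu+1)}{2x}\right)}{1+2\,\mathcal{U}(0,x)}\leq e^{-x}I_\nu(x)\leq\frac{\exp\left(-\frac{\alpha_0}{2x}\nu^2\right)}{1+2\,\mathcal{L}(0,x)}.$$ (2) If $\nu>x$, then $$\frac{e^{-\frac{[x]([x]+1)}{2x}}\,B\left([x]+\frac x2+1,\nu-[x]\right)\frac{(x/2)^{\nu-[x]}}{(\nu-[x]-1)!}}{1+2\,\mathcal{U}(0,x)}\leq e^{-x}I_\nu(x)\leq\frac{e^{-\frac{\alpha_0}{2x}[x]^2}\,B\left([x]+x+\frac12,\nu-[x]\right)\frac{x^{\nu-[x]}}{(\nu-[x]-1)!}}{1+2\,\mathcal{L}(0,x)}.$$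
   Context: $I_\nu$ denotes the modified Bessel function of the first kind, $I_{\nu}(x)=\sum_{k=0}^{\infty}\frac{1}{k!\,\Gamma(k+\nu+1)}\left(\frac{x}{2}\right)^{2k+\nu}$; $B(\cdot,\cdot)$ is the Beta function; $[x]$ is the floor of $x$; $\log$ is the natural logarithm. Put $F(\nu,x)=\frac{x}{\nu+\sqrt{\nu^2+x^2}}$. If $[x]\geq 2$: $$\mathcal{L}(0,x)=\frac{2x\,e^{-\frac1x}}{\frac32+\sqrt{\frac94+4x}}-\frac{2x\,e^{-\frac{1}{2x}([x]+1)([x]+2)}}{[x]+\frac32+\sqrt{\left([x]+\frac32\right)^2+\frac{8x}{\pi}}}+e^{-\frac{([x]-1)[x]}{2x}}F([x],x)\bigl(1+F([x]+1,x)\bigr),$$ $$\mathcal{U}(0,x)=\frac{2x}{\alpha_0}\left[\frac{1}{\sqrt{\frac{8x}{\pi\alpha_0}}}-\frac{e^{-\frac{\alpha_0x}{2}}}{x+\sqrt{x^2+\frac{4x}{\alpha_0}}}\right]+e^{-\frac{\alpha_0}{2x}([x]-1)^2}\,\frac{F\left([x]-\frac12,x\right)}{1-F\left([x]+\frac12,x\right)}.$$ If $[x]<2$: $$\mathcal{L}(0,x)=F(1,x)\bigl(1+F(2,x)\bigr),\qquad \mathcal{U}(0,x)=\frac{F\left(\frac12,x\right)}{1-F\left(\frac32,x\right)}.$$ *)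

theory Defs
  imports "HOL-Analysis.Analysis"
begin

text \<open>
  Modified Bessel function of the first kind, intended for \<open>x > 0\<close> (real powers are
  \<open>powr\<close>). As \<open>Gamma\<close> is 0 at its poles and \<open>1 / 0 = 0\<close>, the usual convention
  \<open>1 / \<Gamma>(-m) = 0\<close> holds.
\<close>
definition bessel_I :: "real \<Rightarrow> real \<Rightarrow> real" where
  "bessel_I \<nu> x =
     (\<Sum>k. 1 / (fact k * Gamma (real k + \<nu> + 1)) * (x / 2) powr (2 * real k + \<nu>))"

definition alpha0 :: real where
  "alpha0 = - ln (sqrt 2 - 1)"

definition F :: "real \<Rightarrow> real \<Rightarrow> real" where
  "F \<nu> x = x / (\<nu> + sqrt (\<nu>\<^sup>2 + x\<^sup>2))"

text \<open>
  \<open>L0 x\<close> and \<open>U0 x\<close> are the quantities \<open>\<L>(0, x)\<close> and \<open>\<U>(0, x)\<close>; \<open>n\<close> is the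
  integer part of \<open>x\<close>, viewed as a real number.
\<close>
definition L0 :: "real \<Rightarrow> real" where
  "L0 x = (let n = real_of_int \<lfloor>x\<rfloor> in
     if \<lfloor>x\<rfloor> \<ge> 2 then
         2 * x * exp (- (1 / x)) / (3 / 2 + sqrt (9 / 4 + 4 * x))
       - 2 * x * exp (- (1 / (2 * x)) * (n + 1) * (n + 2)) /
           (n + 3 / 2 + sqrt ((n + 3 / 2)\<^sup>2 + 8 * x / pi))
       + exp (- ((n - 1) * n / (2 * x))) * F n x * (1 + F (n + 1) x)
     else F 1 x * (1 + F 2 x))"

definition U0 :: "real \<Rightarrow> real" where
  "U0 x = (let n = real_of_int \<lfloor>x\<rfloor> in
     if \<lfloor>x\<rfloor> \<ge> 2 then
         2 * x / alpha0 *
           (1 / sqrt (8 * x / (pi * alpha0))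
            - exp (- (alpha0 * x / 2)) / (x + sqrt (x\<^sup>2 + 4 * x / alpha0)))
       + exp (- (alpha0 / (2 * x)) * (n - 1)\<^sup>2) *
           (F (n - 1 / 2) x / (1 - F (n + 1 / 2) x))
     else F (1 / 2) x / (1 - F (3 / 2) x))"

end

theory Submission
  imports Defs "HOL-Probability.Distributions"
begin

text \<open>
  Since \<open>e\<^sup>x = I\<^sub>0 + 2 (I\<^sub>1 + I\<^sub>2 + \<dots>)\<close>, dividing by \<open>I\<^sub>0\<close> expresses \<open>e\<^bsup>-x\<^esup> I\<^sub>\<nu>\<close> as
  \<open>\<rho>\<^sub>\<nu> / (1 + 2 (\<rho>\<^sub>1 + \<rho>\<^sub>2 + \<dots>))\<close> with \<open>\<rho>\<^sub>n = I\<^sub>n / I\<^sub>0\<close>. The quotients \<open>I\<^sub>n / I\<^sub>n\<^sub>-\<^sub>1\<close> lie between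
  \<open>F n x\<close> and \<open>F (n - 1/2) x\<close>: by the three-term recurrence this amounts to two
  inequalities between \<open>I\<^sub>n\<^sup>2\<close>, \<open>I\<^sub>n\<^sub>-\<^sub>1 I\<^sub>n\<^sub>+\<^sub>1\<close> and \<open>I\<^sub>n\<^sub>-\<^sub>1 I\<^sub>n\<close>, which hold coefficientwise. As
  \<open>F t x = exp (- arsinh (t / x))\<close>, products of the \<open>F\<close> are bounded by Gaussians, whose sums
  are compared with integrals and with bounds for the Gaussian tail.
\<close>

subsection \<open>Products of Bessel functions\<close>

text \<open>The two Gaussian rates come from linear bounds on arsinh: on [0, \<infinity>) it lies
  below the identity, and on [0, 1] it is concave and so lies above its chord, whose slope arsinh 1
  is \<open>alpha0\<close>. The chord bound requires t \<le> x, hence the case split of the theorem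
  at x. Beyond [x] the quotients are enclosed by x / (2t + x) and x / (t + x) instead, and products
  of such fractions over consecutive t are Beta functions. The delicate quantity is
  \<open>L0\<close>. Its first two summands have the shape of a lower and an upper estimate of
  Gaussian tails starting at 3/2 and at [x] + 3/2; the 8x/\<pi> is the mark of the classical upper
  tail estimate. Together they stand for an integral that already accounts for the indices 1 to [x],
  while the third summand accounts for [x] and [x] + 1. The surplus has to be recovered from
  numerical margins, which forces separate arguments for small [x].\<close>

lemma bessel_I_sums:
  assumes "x > 0"
  shows "(\<lambda>k. (x / 2) ^ (2 * k + n) / (fact k * fact (k + n))) sums bessel_I (real n) x"
proof -
  have term_eq: "1 / (fact k * Gamma (real k + real n + 1)) * (x / 2) powr (2 * real k + real n)
      = (x / 2) ^ (2 * k + n) / (fact k * fact (k + n))" for k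
  proof -
    have "Gamma (real k + real n + 1) = fact (k + n)"
      using Gamma_fact[of "k + n", where 'a = real] by (simp add: ac_simps)
    moreover have "(x / 2) powr (2 * real k + real n) = (x / 2) ^ (2 * k + n)"
      using powr_realpow[of "x / 2" "2 * k + n"] assms by simp
    ultimately show ?thesis by simp
  qed
  have "summable (\<lambda>k. (x / 2) ^ (2 * k + n) / (fact k * fact (k + n)))"
  proof (rule summable_comparison_test')
    show "summable (\<lambda>k. (x / 2) ^ n * (inverse (fact k) * ((x / 2)\<^sup>2) ^ k))"
      by (intro summable_mult summable_exp)
    fix k :: nat
    have "(x / 2) ^ (2 * k + n) / (fact k * fact (k + n)) \<le> (x / 2) ^ (2 * k + n) / (fact k * 1)"
      using assms by (intro divide_left_mono mult_left_mono) auto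
    also have "\<dots> = (x / 2) ^ n * (inverse (fact k) * ((x / 2)\<^sup>2) ^ k)"
      unfolding power_add power_mult by (simp only: divide_inverse mult_1_right mult_1_left mult_ac)
    finally show "norm ((x / 2) ^ (2 * k + n) / (fact k * fact (k + n)))
        \<le> (x / 2) ^ n * (inverse (fact k) * ((x / 2)\<^sup>2) ^ k)"
      using assms by simp
  qed
  then show ?thesis
    unfolding bessel_I_def term_eq by (rule summable_sums)
qed

lemma bessel_I_pos:
  assumes "x > 0"
  shows "bessel_I (real n) x > 0"
proof -
  have "0 < (\<Sum>k. (x / 2) ^ (2 * k + n) / (fact k * fact (k + n)))"
    using bessel_I_sums[OF assms, of n] assms
    by (intro suminf_pos) (auto simp: sums_iff)
  then show ?thesis
    using bessel_I_sums[OF assms, of n] by (simp add: sums_iff)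
qed

lemma bessel_I_recurrence:
  assumes "x > 0"
  shows "bessel_I (real n) x - bessel_I (real (n + 2)) x
           = 2 * real (n + 1) / x * bessel_I (real (n + 1)) x"
proof -
  let ?y = "x / 2"
  \<comment> \<open>The factor k makes the term at 0 vanish and otherwise cancels against
    \<open>fact k\<close>, so shifting the index by one turns \<open>h\<close> into the series of
    order n + 2.\<close>
  define h where "h k = real k * ?y ^ (2 * k + n) / (fact k * fact (k + n + 1))" for k
  have y: "?y \<noteq> 0" using assms by simp
  have "(\<lambda>k. ?y ^ (2 * k + n) / (fact k * fact (k + n))
      - real (n + 1) / ?y * (?y ^ (2 * k + (n + 1)) / (fact k * fact (k + (n + 1)))))
      sums (bessel_I (real n) x - real (n + 1) / ?y * bessel_I (real (n + 1)) x)"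
    by (intro sums_diff sums_mult bessel_I_sums assms)
  also have "(\<lambda>k. ?y ^ (2 * k + n) / (fact k * fact (k + n))
      - real (n + 1) / ?y * (?y ^ (2 * k + (n + 1)) / (fact k * fact (k + (n + 1))))) = h"
  proof
    fix k
    define A where "A = ?y ^ (2 * k + n) / (fact k * fact (k + n))"
    have f: "fact (k + n + 1) = (real k + real n + 1) * fact (k + n)" by simp
    have E1: "real (n + 1) / ?y * (?y ^ (2 * k + (n + 1)) / (fact k * fact (k + (n + 1))))
        = real (n + 1) / (real k + real n + 1) * A"
    proof -
      have "p / w * (w * Y / (a * (c * b))) = p / c * (Y / (a * b))" if "w \<noteq> 0"
        for p w Y a b c :: real using that by simp
      moreover have "?y ^ (2 * k + (n + 1)) = ?y * ?y ^ (2 * k + n)" by simp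
      moreover have "fact (k + (n + 1)) = (real k + real n + 1) * fact (k + n)"
        using f by (simp only: add.assoc)
      ultimately show ?thesis unfolding A_def using y by metis
    qed
    have E2: "h k = real k / (real k + real n + 1) * A"
      unfolding h_def f A_def by simp
    have pos: "real k + real n + 1 > 0" by simp
    show "?y ^ (2 * k + n) / (fact k * fact (k + n))
      - real (n + 1) / ?y * (?y ^ (2 * k + (n + 1)) / (fact k * fact (k + (n + 1)))) = h k"
      unfolding E1 E2 A_def[symmetric] using pos by (simp add: field_simps)
  qed
  finally have h: "h sums (bessel_I (real n) x - real (n + 1) / ?y * bessel_I (real (n + 1)) x)" .
  have "h (Suc k) = ?y ^ (2 * k + (n + 2)) / (fact k * fact (k + (n + 2)))" for k
    unfolding h_def by (simp del: of_nat_Suc)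
  then have "(\<lambda>k. h (Suc k)) sums bessel_I (real (n + 2)) x"
    using bessel_I_sums[OF assms, of "n + 2"] by simp
  then have "h sums (bessel_I (real (n + 2)) x)"
    using sums_Suc[of h] by (simp add: h_def)
  with h have "bessel_I (real n) x - real (n + 1) / ?y * bessel_I (real (n + 1)) x
      = bessel_I (real (n + 2)) x"
    using sums_unique2 by blast
  then show ?thesis by (simp add: field_simps)
qed

text \<open>Each coefficient of the Cauchy product is a convolution of two rows of binomial
  coefficients, which Vandermonde's identity collapses. Products with equal p + q then share the
  power of x and the binomial coefficient and differ only in the two factorials of the denominator,
  so they can be compared term by term.\<close>

lemma bessel_I_mult_sums:
  assumes "x > 0"
  shows "(\<lambda>m. (x / 2) ^ (2 * m + p + q) * real ((2 * m + p + q) choose m)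
            / (fact (m + p) * fact (m + q)))
          sums (bessel_I (real p) x * bessel_I (real q) x)"
proof -
  let ?y = "x / 2"
  define t where "t n k = ?y ^ (2 * k + n) / (fact k * fact (k + n))" for n k :: nat
  have t: "t n sums bessel_I (real n) x" for n
    unfolding t_def by (rule bessel_I_sums[OF assms])
  have nonneg: "norm (t n k) = t n k" for n k
    using assms by (simp add: t_def)
  have "(\<lambda>m. \<Sum>i\<le>m. t p i * t q (m - i)) sums ((\<Sum>k. t p k) * (\<Sum>k. t q k))"
    by (rule Cauchy_product_sums) (use t nonneg in \<open>auto simp: sums_iff\<close>)
  moreover have "(\<Sum>i\<le>m. t p i * t q (m - i))
      = ?y ^ (2 * m + p + q) * real ((2 * m + p + q) choose m) / (fact (m + p) * fact (m + q))" for m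
  proof -
    have "t p i * t q (m - i) = ?y ^ (2 * m + p + q) / (fact (m + p) * fact (m + q))
        * (real ((m + q) choose i) * real ((m + p) choose (m - i)))" if i: "i \<le> m" for i
    proof -
      obtain j where m: "m = i + j" using le_Suc_ex[OF i] by blast
      have "real ((m + q) choose i) = fact (m + q) / (fact i * fact (j + q))"
        using binomial_fact[of i "m + q", where 'a = real] by (simp add: m)
      moreover have "real ((m + p) choose j) = fact (m + p) / (fact j * fact (i + p))"
        using binomial_fact[of j "m + p", where 'a = real] by (simp add: m)
      moreover have "?y ^ (2 * i + p) * ?y ^ (2 * j + q) = ?y ^ (2 * m + p + q)"
        unfolding m by (simp add: power_add[symmetric] algebra_simps)
      ultimately show ?thesis
        by (simp add: t_def m)
    qed
    then have "(\<Sum>i\<le>m. t p i * t q (m - i)) = (\<Sum>i\<le>m. ?y ^ (2 * m + p + q)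
        / (fact (m + p) * fact (m + q)) * (real ((m + q) choose i) * real ((m + p) choose (m - i))))"
      by (intro sum.cong) auto
    also have "\<dots> = ?y ^ (2 * m + p + q) / (fact (m + p) * fact (m + q))
        * real (\<Sum>i\<le>m. ((m + q) choose i) * ((m + p) choose (m - i)))"
      unfolding sum_distrib_left[symmetric] of_nat_sum of_nat_mult ..
    finally have "(\<Sum>i\<le>m. t p i * t q (m - i)) = ?y ^ (2 * m + p + q)
        / (fact (m + p) * fact (m + q)) * real (\<Sum>i\<le>m. ((m + q) choose i) * ((m + p) choose (m - i)))" .
    moreover have "m + q + (m + p) = 2 * m + p + q" by simp
    ultimately show ?thesis by (simp add: vandermonde)
  qed
  ultimately show ?thesis
    using t by (simp add: sums_iff)
qed

text \<open>Both products have p + q = 2n + 2, so only the denominators matter, and their comparison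
  reduces to m + n + 1 \<le> m + n + 2.\<close>

lemma bessel_I_turan:
  assumes "x > 0"
  shows "bessel_I (real n) x * bessel_I (real (n + 2)) x \<le> (bessel_I (real (n + 1)) x)\<^sup>2"
  unfolding power2_eq_square
proof (rule sums_le[OF _ bessel_I_mult_sums[OF assms] bessel_I_mult_sums[OF assms]])
  fix m
  have "(fact (m + (n + 1)) * fact (m + (n + 1)) :: real) \<le> fact (m + n) * fact (m + (n + 2))"
    by (simp add: algebra_simps)
  then show "(x / 2) ^ (2 * m + n + (n + 2)) * real ((2 * m + n + (n + 2)) choose m)
      / (fact (m + n) * fact (m + (n + 2)))
    \<le> (x / 2) ^ (2 * m + (n + 1) + (n + 1)) * real ((2 * m + (n + 1) + (n + 1)) choose m)
      / (fact (m + (n + 1)) * fact (m + (n + 1)))"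
    using assms by (auto intro!: divide_left_mono simp del: fact_Suc)
qed

text \<open>The coefficient of the last product is taken one index further, which compensates the
  factor \<open>1 / x\<close>; the comparison then rests on \<open>2 (N choose m) \<le> (N + 1 choose m + 1)\<close>.\<close>
lemma bessel_I_turan_upper:
  assumes "x > 0"
  shows "(bessel_I (real (n + 1)) x)\<^sup>2
      \<le> bessel_I (real n) x * bessel_I (real (n + 2)) x
        + bessel_I (real n) x * bessel_I (real (n + 1)) x / x"
proof -
  let ?y = "x / 2"
  let ?a = "\<lambda>p q m. ?y ^ (2 * m + p + q) * real ((2 * m + p + q) choose m)
    / (fact (m + p) * fact (m + q))"
  define s where "s = bessel_I (real n) x * bessel_I (real (n + 1)) x"
  have "(\<lambda>m. ?a n (n + 1) m / x) sums (s / x)"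
    unfolding s_def by (intro sums_divide bessel_I_mult_sums assms)
  then have shifted: "(\<lambda>m. ?a n (n + 1) (Suc m) / x) sums (s / x - ?a n (n + 1) 0 / x)"
    by (subst sums_Suc_iff) simp
  have "bessel_I (real (n + 1)) x * bessel_I (real (n + 1)) x
    \<le> bessel_I (real n) x * bessel_I (real (n + 2)) x + (s / x - ?a n (n + 1) 0 / x)"
  proof (rule sums_le[OF _ bessel_I_mult_sums[OF assms]
        sums_add[OF bessel_I_mult_sums[OF assms] shifted]])
    fix m
    define N where "N = 2 * m + n + n + 2"
    define P where "P = ?y ^ N / (fact (m + n + 1) * fact (m + n + 2))"
    have P: "P \<ge> 0" unfolding P_def using assms by simp
    have binom: "2 * real (N choose m) \<le> real (Suc N choose Suc m)"
    proof -
      have "Suc m * (Suc N choose Suc m) = Suc N * (N choose m)"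
        by (rule Suc_times_binomial)
      moreover have "Suc m * (2 * (N choose m)) \<le> Suc N * (N choose m)"
        by (simp add: N_def algebra_simps)
      ultimately have "Suc m * (2 * (N choose m)) \<le> Suc m * (Suc N choose Suc m)"
        by simp
      then have "2 * (N choose m) \<le> (Suc N choose Suc m)"
        by (simp only: mult_le_cancel1)
      then have "real (2 * (N choose m)) \<le> real (Suc N choose Suc m)"
        by (simp only: of_nat_le_iff)
      then show ?thesis by simp
    qed
    have f1: "fact (m + n + 1) = (real m + real n + 1) * fact (m + n)" by simp
    have f2: "fact (m + n + 2) = (real m + real n + 2) * fact (m + n + 1)" by simp
    have e1: "?a (n + 1) (n + 1) m = (real m + real n + 2) * P * real (N choose m)"
    proof -
      have "2 * m + (n + 1) + (n + 1) = N" by (simp add: N_def)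
      then show ?thesis unfolding P_def f2 by (simp del: fact_Suc add: add.assoc)
    qed
    have e2: "?a n (n + 2) m = (real m + real n + 1) * P * real (N choose m)"
    proof -
      have "2 * m + n + (n + 2) = N" by (simp add: N_def)
      then show ?thesis unfolding P_def f1 by (simp del: fact_Suc add: add.assoc)
    qed
    have e3: "?a n (n + 1) (Suc m) / x = P * real (Suc N choose Suc m) / 2"
    proof -
      have "2 * Suc m + n + (n + 1) = Suc N" "Suc m + n = m + n + 1" "Suc m + (n + 1) = m + n + 2"
        by (simp_all add: N_def)
      then show ?thesis unfolding P_def using assms by (simp del: fact_Suc binomial_Suc_Suc)
    qed
    have "P * (2 * real (N choose m)) \<le> P * real (Suc N choose Suc m)"
      by (rule mult_left_mono[OF binom P])
    then show "?a (n + 1) (n + 1) m \<le> ?a n (n + 2) m + ?a n (n + 1) (Suc m) / x"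
      unfolding e1 e2 e3 by (simp add: algebra_simps)
  qed
  moreover have "?a n (n + 1) 0 / x \<ge> 0" using assms by simp
  ultimately show ?thesis unfolding s_def power2_eq_square by simp
qed

text \<open>Expand \<open>e\<^bsup>x/2\<^esup> * e\<^bsup>x/2\<^esup>\<close> and collect the terms with fixed difference of the exponents.\<close>
lemma bessel_I_generating:
  assumes "x > 0"
  shows "(\<lambda>n. bessel_I (real (n + 1)) x) sums ((exp x - bessel_I 0 x) / 2)"
proof -
  let ?y = "x / 2"
  define e where "e n = ?y ^ n / fact n" for n :: nat
  define g where "g = (\<lambda>(a, b). e a * e b)"
  have e_pos: "e n \<ge> 0" for n using assms by (simp add: e_def)
  have "e sums exp ?y"
    using exp_converges[of ?y] by (simp add: e_def[abs_def] field_simps)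
  then have e_sum: "(e has_sum exp ?y) UNIV"
    by (intro norm_summable_imp_has_sum) (auto simp: sums_iff e_pos)
  have inner: "((\<lambda>b. g (a, b)) has_sum e a * exp ?y) UNIV" for a
    unfolding g_def prod.case by (rule has_sum_cmult_right[OF e_sum])
  have outer: "((\<lambda>a. e a * exp ?y) has_sum exp ?y * exp ?y) UNIV"
    by (rule has_sum_cmult_left[OF e_sum])
  have "g summable_on UNIV \<times> UNIV"
    by (rule summable_on_SigmaI[OF inner]) (use outer in \<open>auto intro: has_sum_imp_summable simp: g_def e_pos\<close>)
  then have g_sum: "(g has_sum exp ?y * exp ?y) (UNIV \<times> UNIV)"
    by (rule has_sum_SigmaI[OF inner outer])
  have bes: "((\<lambda>m. e (m + n) * e m) has_sum bessel_I (real n) x) UNIV" for n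
  proof -
    have eq: "e (m + n) * e m = ?y ^ (2 * m + n) / (fact m * fact (m + n))" for m
    proof -
      have "?y ^ (2 * m + n) = ?y ^ (m + n) * ?y ^ m"
        by (simp add: power_add[symmetric] mult_2 add_ac)
      then show ?thesis by (simp add: e_def)
    qed
    show ?thesis
      unfolding eq using bessel_I_sums[OF assms, of n] assms
      by (intro norm_summable_imp_has_sum) (auto simp: sums_iff)
  qed
  define D where "D = {(a, b). (b::nat) < a}"
  define D' where "D' = {(a, b). (a::nat) < b}"
  define E where "E = {(a, b). (a::nat) = b}"
  define T where "T = infsum g D"
  have "g summable_on D"
    by (rule summable_on_subset[OF has_sum_imp_summable[OF g_sum]]) simp
  then have D: "(g has_sum T) D" unfolding T_def by (rule has_sum_infsum)
  have "(g has_sum T) D' \<longleftrightarrow> (g has_sum T) D"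
    by (rule has_sum_reindex_bij_witness[where i = prod.swap and j = prod.swap])
       (auto simp: D_def D'_def g_def mult.commute)
  with D have D': "(g has_sum T) D'" by simp
  have "(g has_sum bessel_I 0 x) E \<longleftrightarrow> ((\<lambda>m. e (m + 0) * e m) has_sum bessel_I 0 x) UNIV"
    by (rule has_sum_reindex_bij_witness[where i = "\<lambda>m. (m, m)" and j = fst])
       (auto simp: E_def g_def)
  with bes[of 0] have E: "(g has_sum bessel_I 0 x) E" by simp
  \<comment> \<open>The pairs of \<open>D\<close> are parametrised by the difference k + 1 of the
    exponents and the smaller exponent m; the subtraction \<open>a - b - 1\<close> is not truncated
    because b < a on \<open>D\<close>.\<close>
  have "((\<lambda>(k, m). e (m + (k + 1)) * e m) has_sum T) (UNIV \<times> UNIV) \<longleftrightarrow> (g has_sum T) D"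
    by (rule has_sum_reindex_bij_witness[where i = "\<lambda>(a, b). (a - b - 1, b)"
          and j = "\<lambda>(k, m). (m + (k + 1), m)"]) (auto simp: D_def g_def)
  with D have "((\<lambda>(k, m). e (m + (k + 1)) * e m) has_sum T) (UNIV \<times> UNIV)" by simp
  then have "((\<lambda>k. bessel_I (real (k + 1)) x) has_sum T) UNIV"
    by (rule has_sum_SigmaD) (simp only: prod.case bes)
  then have sums: "(\<lambda>k. bessel_I (real (k + 1)) x) sums T"
    by (rule has_sum_imp_sums)
  have "(g has_sum T + T + bessel_I 0 x) (D \<union> D' \<union> E)"
    by (intro has_sum_Un_disjoint D D' E) (auto simp: D_def D'_def E_def)
  also have "D \<union> D' \<union> E = UNIV \<times> UNIV"
    by (auto simp: D_def D'_def E_def)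
  finally have "T + T + bessel_I 0 x = exp ?y * exp ?y"
    using g_sum has_sum_unique by blast
  also have "\<dots> = exp x" by (simp add: exp_add[symmetric])
  finally have "T = (exp x - bessel_I 0 x) / 2" by simp
  with sums show ?thesis by simp
qed

subsection \<open>Bounds for quotients of Bessel functions\<close>

lemma F_pos: "x > 0 \<Longrightarrow> t \<ge> 0 \<Longrightarrow> F t x > 0"
  unfolding F_def by (intro divide_pos_pos add_nonneg_pos) (auto intro: add_nonneg_pos)

lemma arsinh_le_iff_real: "arsinh x \<le> arsinh y \<longleftrightarrow> x \<le> (y :: real)"
  by (simp flip: not_less)

lemma F_eq_exp_arsinh:
  assumes "x > 0" "t \<ge> 0"
  shows "F t x = exp (- arsinh (t / x))"
proof -
  have "sqrt ((t / x)\<^sup>2 + 1) = sqrt (t\<^sup>2 + x\<^sup>2) / x"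
  proof -
    have "(t / x)\<^sup>2 + 1 = (t\<^sup>2 + x\<^sup>2) / x\<^sup>2"
      using assms by (simp add: power_divide add_divide_distrib)
    then show ?thesis using assms by (simp add: real_sqrt_divide)
  qed
  then have "t / x + sqrt ((t / x)\<^sup>2 + 1) = (t + sqrt (t\<^sup>2 + x\<^sup>2)) / x"
    by (simp add: add_divide_distrib)
  moreover have "t / x + sqrt ((t / x)\<^sup>2 + 1) > 0"
    by (rule arsinh_real_aux)
  ultimately show ?thesis
    unfolding F_def arsinh_real_def exp_minus by simp
qed

lemma F_lower_exp:
  assumes "x > 0" "t \<ge> 0"
  shows "exp (- (t / x)) \<le> F t x"
proof -
  have "t / x \<le> sinh (t / x)"
    using real_le_x_sinh[of "t / x"] assms by (simp add: sinh_field_def exp_minus)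
  then have "arsinh (t / x) \<le> t / x"
    by (metis arsinh_sinh_real arsinh_le_iff_real)
  then show ?thesis using assms by (simp add: F_eq_exp_arsinh)
qed

lemma alpha0_eq_arsinh: "alpha0 = arsinh 1"
proof -
  have "(sqrt 2 - 1) * (1 + sqrt 2) = (1::real)" by (simp add: algebra_simps)
  then have "inverse (sqrt 2 - 1) = 1 + sqrt (2::real)"
    by (metis inverse_unique)
  moreover have "sqrt 2 - 1 > (0::real)" by simp
  ultimately show ?thesis
    unfolding alpha0_def arsinh_real_def by (simp add: ln_inverse[symmetric])
qed

lemma alpha0_pos: "alpha0 > 0"
  by (simp add: alpha0_eq_arsinh)

lemma sinh_convex: "convex_on {0..} (sinh :: real \<Rightarrow> real)"
  by (rule f''_ge0_imp_convex[where f' = cosh and f'' = sinh])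
     (auto intro!: derivative_eq_intros)

text \<open>By convexity sinh lies below its chord from 0 to \<open>alpha0\<close>, where it takes
  the value 1. Hence sinh (\<open>alpha0\<close> u) \<le> u for u = t / x in [0, 1], and arsinh
  inverts this.\<close>

lemma F_upper_exp:
  assumes "x > 0" "0 \<le> t" "t \<le> x"
  shows "F t x \<le> exp (- (alpha0 * t / x))"
proof -
  define u where "u = t / x"
  have u: "0 \<le> u" "u \<le> 1" using assms by (auto simp: u_def)
  have "sinh ((1 - u) * 0 + u * alpha0) \<le> (1 - u) * sinh 0 + u * sinh alpha0"
    using convex_onD[OF sinh_convex, of u 0 alpha0] u alpha0_pos by simp
  then have "sinh (alpha0 * u) \<le> u"
    by (simp add: alpha0_eq_arsinh mult.commute)
  then have "alpha0 * u \<le> arsinh u"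
    by (metis arsinh_sinh_real arsinh_le_iff_real)
  then show ?thesis using assms by (simp add: F_eq_exp_arsinh u_def)
qed

lemma F_antimono:
  assumes "x > 0" "0 \<le> s" "s \<le> t"
  shows "F t x \<le> F s x"
  using assms by (simp add: F_eq_exp_arsinh arsinh_le_iff_real divide_right_mono)

lemma F_less_1:
  assumes "x > 0" "t > 0"
  shows "F t x < 1"
  using assms by (simp add: F_eq_exp_arsinh)

lemma F_root:
  assumes "x > 0" "t \<ge> 0"
  shows "x * (F t x)\<^sup>2 + 2 * t * F t x = x"
proof -
  define s where "s = sqrt (t\<^sup>2 + x\<^sup>2)"
  have s: "s\<^sup>2 = t\<^sup>2 + x\<^sup>2" "s > 0" using assms by (auto simp: s_def add_nonneg_pos)
  have "(t + s) * (s - t) = x * x" using s(1) by (simp add: power2_eq_square algebra_simps)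
  moreover have "t + s > 0" using s assms by simp
  ultimately have F: "F t x = (s - t) / x"
    unfolding F_def s_def[symmetric] using assms by (simp add: field_simps)
  show ?thesis unfolding F using assms s(1) by (simp add: field_simps power2_eq_square)
qed

text \<open>\<open>F t x\<close> is the positive root of the quadratic x r^2 + 2 t r - x, whose
  cofactor is positive for r > 0. This converts quadratic inequalities for a quotient of Bessel
  functions into comparisons with \<open>F\<close>.\<close>

lemma F_le_iff:
  assumes "x > 0" "t \<ge> 0" "r > 0"
  shows "F t x \<le> r \<longleftrightarrow> x \<le> x * r\<^sup>2 + 2 * t * r"
proof -
  have "(x * r\<^sup>2 + 2 * t * r) - x = (r - F t x) * (x * (r + F t x) + 2 * t)"
    using F_root[OF assms(1,2)] by (simp add: power2_eq_square algebra_simps)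
  moreover have "x * (r + F t x) + 2 * t > 0"
    using assms F_pos[of x t] by (intro add_pos_nonneg mult_pos_pos) auto
  ultimately show ?thesis
    by (smt (verit) mult_nonneg_nonneg mult_neg_pos)
qed

text \<open>Eliminating the function of order n + 2 from \<open>bessel_I_turan\<close> by the
  recurrence leaves a quadratic inequality for the quotient b / a, namely the one of
  \<open>F_le_iff\<close> with t = n + 1.\<close>

lemma bessel_I_ratio_lower:
  assumes "x > 0"
  shows "F (real (n + 1)) x * bessel_I (real n) x \<le> bessel_I (real (n + 1)) x"
proof -
  define a b c where "a = bessel_I (real n) x" "b = bessel_I (real (n + 1)) x"
    "c = bessel_I (real (n + 2)) x"
  have pos: "a > 0" "b > 0" unfolding a_b_c_def by (intro bessel_I_pos assms)+
  have rec: "x * a - x * c = 2 * real (n + 1) * b"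
    using bessel_I_recurrence[OF assms, of n] assms unfolding a_b_c_def[symmetric]
    by (simp add: field_simps)
  have "a * c \<le> b\<^sup>2"
    using bessel_I_turan[OF assms, of n] unfolding a_b_c_def[symmetric] .
  then have "x * (a * c) \<le> x * b\<^sup>2" using assms by simp
  moreover have "x * (a * c) = x * a\<^sup>2 - 2 * real (n + 1) * b * a"
    using arg_cong[OF rec, of "\<lambda>z. z * a"] by (simp add: power2_eq_square algebra_simps)
  ultimately have "x * a\<^sup>2 \<le> x * b\<^sup>2 + 2 * real (n + 1) * b * a" by simp
  then have "x * a\<^sup>2 / a\<^sup>2 \<le> (x * b\<^sup>2 + 2 * real (n + 1) * b * a) / a\<^sup>2"
    by (intro divide_right_mono) auto
  then have "x \<le> x * (b / a)\<^sup>2 + 2 * real (n + 1) * (b / a)"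
    using pos by (simp add: add_divide_distrib power2_eq_square)
  then have "F (real (n + 1)) x \<le> b / a"
    using F_le_iff[of x "real (n + 1)" "b / a"] pos assms by simp
  then show ?thesis unfolding a_b_c_def[symmetric] using pos by (simp add: field_simps)
qed

text \<open>The same elimination in \<open>bessel_I_turan_upper\<close>: the extra summand a b / x
  lowers the linear coefficient from 2n + 2 to 2n + 1, which is the origin of the shift by
  1/2.\<close>

lemma bessel_I_ratio_upper:
  assumes "x > 0"
  shows "bessel_I (real (n + 1)) x \<le> F (real n + 1 / 2) x * bessel_I (real n) x"
proof -
  define a b c where "a = bessel_I (real n) x" "b = bessel_I (real (n + 1)) x"
    "c = bessel_I (real (n + 2)) x"
  have pos: "a > 0" "b > 0" unfolding a_b_c_def by (intro bessel_I_pos assms)+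
  have rec: "x * a - x * c = 2 * real (n + 1) * b"
    using bessel_I_recurrence[OF assms, of n] assms unfolding a_b_c_def[symmetric]
    by (simp add: field_simps)
  define t where "t = real n + 1 / 2"
  have t: "2 * real (n + 1) = 2 * t + 1" by (simp add: t_def)
  have "b\<^sup>2 \<le> a * c + a * b / x"
    using bessel_I_turan_upper[OF assms, of n] unfolding a_b_c_def[symmetric] .
  then have "x * b\<^sup>2 \<le> x * (a * c + a * b / x)" using assms by simp
  then have "x * b\<^sup>2 \<le> x * (a * c) + a * b" using assms by (simp add: algebra_simps)
  moreover have "x * (a * c) = x * a\<^sup>2 - (2 * t + 1) * b * a"
    using arg_cong[OF rec, of "\<lambda>z. z * a"] unfolding t by (simp add: power2_eq_square algebra_simps)
  ultimately have le: "x * b\<^sup>2 + 2 * t * b * a \<le> x * a\<^sup>2" by (simp add: algebra_simps)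
  have "b / a \<le> F t x"
  proof (rule ccontr)
    assume "\<not> b / a \<le> F t x"
    then have "F t x < b / a" by simp
    then have "x * (F t x)\<^sup>2 + 2 * t * F t x < x * (b / a)\<^sup>2 + 2 * t * (b / a)"
      using assms F_pos[of x t] by (intro add_less_le_mono mult_strict_left_mono power_strict_mono mult_left_mono)
        (auto simp: t_def)
    then have "x * a\<^sup>2 < (x * (b / a)\<^sup>2 + 2 * t * (b / a)) * a\<^sup>2"
      using F_root[of x t] assms pos by (simp add: t_def)
    also have "\<dots> = x * b\<^sup>2 + 2 * t * b * a"
      using pos by (simp add: field_simps power2_eq_square)
    finally show False using le by simp
  qed
  then show ?thesis unfolding a_b_c_def[symmetric] t_def[symmetric] using pos by (simp add: field_simps)
qed

lemma bessel_I_prod_lower: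
  assumes "x > 0"
  shows "bessel_I (real n) x * (\<Prod>j<d. F (real (n + j + 1)) x) \<le> bessel_I (real (n + d)) x"
proof (induction d)
  case (Suc d)
  have "bessel_I (real n) x * (\<Prod>j<Suc d. F (real (n + j + 1)) x)
      \<le> F (real (n + d + 1)) x * bessel_I (real (n + d)) x"
    using mult_left_mono[OF Suc, of "F (real (n + d + 1)) x"] F_pos[OF assms, of "real (n + d + 1)"]
    by (simp add: ac_simps)
  also have "\<dots> \<le> bessel_I (real (n + Suc d)) x"
    using bessel_I_ratio_lower[OF assms, of "n + d"] by simp
  finally show ?case .
qed simp

lemma bessel_I_prod_upper:
  assumes "x > 0"
  shows "bessel_I (real (n + d)) x \<le> bessel_I (real n) x * (\<Prod>j<d. F (real (n + j) + 1 / 2) x)"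
proof (induction d)
  case (Suc d)
  have "bessel_I (real (n + Suc d)) x \<le> F (real (n + d) + 1 / 2) x * bessel_I (real (n + d)) x"
    using bessel_I_ratio_upper[OF assms, of "n + d"] by simp
  also have "\<dots> \<le> bessel_I (real n) x * (\<Prod>j<Suc d. F (real (n + j) + 1 / 2) x)"
    using mult_left_mono[OF Suc, of "F (real (n + d) + 1 / 2) x"] F_pos[OF assms, of "real (n + d) + 1 / 2"]
    by (simp add: ac_simps)
  finally show ?case .
qed simp

section \<open>Bessel functions normalised by their value of order 0\<close>

definition bessel_ratio :: "nat \<Rightarrow> real \<Rightarrow> real" where
  "bessel_ratio n x = bessel_I (real n) x / bessel_I 0 x"

lemma bessel_I_0_pos: "x > 0 \<Longrightarrow> bessel_I 0 x > 0"
  using bessel_I_pos[of x 0] by simp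

lemma bessel_ratio_pos: "x > 0 \<Longrightarrow> bessel_ratio n x > 0"
  by (simp add: bessel_ratio_def bessel_I_pos bessel_I_0_pos del: of_nat_Suc)

lemma bessel_ratio_Suc_lower:
  "x > 0 \<Longrightarrow> bessel_ratio n x * F (real n + 1) x \<le> bessel_ratio (Suc n) x"
  using bessel_I_ratio_lower[of x n] bessel_I_0_pos[of x]
  by (simp add: bessel_ratio_def divide_simps ac_simps)

lemma bessel_ratio_Suc_upper:
  "x > 0 \<Longrightarrow> bessel_ratio (Suc n) x \<le> bessel_ratio n x * F (real n + 1 / 2) x"
  using bessel_I_ratio_upper[of x n] bessel_I_0_pos[of x]
  by (simp add: bessel_ratio_def divide_simps ac_simps)

text \<open>The exponents of the factors add up to (1 + 2 + ... + n) / x.\<close>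

lemma bessel_ratio_lower_exp:
  assumes "x > 0"
  shows "exp (- (real n * (real n + 1) / (2 * x))) \<le> bessel_ratio n x"
proof (induction n)
  case 0
  then show ?case using bessel_I_0_pos[OF assms] by (simp add: bessel_ratio_def)
next
  case (Suc n)
  have "exp (- (real (Suc n) * (real (Suc n) + 1) / (2 * x)))
      = exp (- (real n * (real n + 1) / (2 * x))) * exp (- ((real n + 1) / x))"
    unfolding exp_add[symmetric] using assms by (simp add: field_simps)
  also have "\<dots> \<le> bessel_ratio n x * F (real n + 1) x"
    using Suc bessel_ratio_pos[OF assms, of n] F_lower_exp[OF assms, of "real n + 1"]
    by (intro mult_mono) auto
  also have "\<dots> \<le> bessel_ratio (Suc n) x" by (rule bessel_ratio_Suc_lower[OF assms])
  finally show ?case .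
qed

text \<open>Here the exponents come from 1/2 + 3/2 + ... + (n - 1/2) = n^2 / 2. All these arguments
  are below x because n \<le> x, so the chord bound applies to every factor.\<close>

lemma bessel_ratio_upper_exp:
  assumes "x > 0" "real n \<le> x"
  shows "bessel_ratio n x \<le> exp (- (alpha0 / (2 * x)) * (real n)\<^sup>2)"
  using assms(2)
proof (induction n)
  case 0
  then show ?case using bessel_I_0_pos[OF assms(1)] by (simp add: bessel_ratio_def)
next
  case (Suc n)
  have "bessel_ratio (Suc n) x \<le> bessel_ratio n x * F (real n + 1 / 2) x"
    by (rule bessel_ratio_Suc_upper[OF assms(1)])
  also have "\<dots> \<le> exp (- (alpha0 / (2 * x)) * (real n)\<^sup>2) * exp (- (alpha0 * (real n + 1 / 2) / x))"
    using Suc F_pos[OF assms(1), of "real n + 1 / 2"] F_upper_exp[OF assms(1), of "real n + 1 / 2"]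
    by (intro mult_mono) auto
  also have "\<dots> = exp (- (alpha0 / (2 * x)) * (real (Suc n))\<^sup>2)"
    unfolding exp_add[symmetric] using assms(1) by (simp add: field_simps power2_eq_square)
  finally show ?case .
qed

text \<open>Beta at (a, d) equals (d - 1)! divided by the rising factorial of a of length d. This is
  how products of rational bounds for the quotients acquire the form stated for \<nu> > x.\<close>

lemma Beta_power_eq_prod:
  fixes a y :: real
  assumes "a > 0" "d \<ge> 1"
  shows "Beta a (real d) * (y ^ d / fact (d - 1)) = (\<Prod>j<d. y / (a + real j))"
proof -
  have "a \<notin> \<int>\<^sub>\<le>\<^sub>0" using assms by (auto elim!: nonpos_Ints_cases)
  then have "pochhammer a d = Gamma (a + real d) / Gamma a" by (rule pochhammer_Gamma)
  moreover have "Gamma (real d) = fact (d - 1)"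
    using Gamma_fact[of "d - 1", where 'a = real] assms by (simp add: of_nat_diff)
  moreover have "Gamma a > 0" "Gamma (a + real d) > 0" using assms by (auto intro: Gamma_real_pos)
  ultimately have "Beta a (real d) * (y ^ d / fact (d - 1)) = y ^ d / pochhammer a d"
    by (simp add: Beta_def)
  also have "\<dots> = (\<Prod>j<d. y / (a + real j))"
    by (simp add: pochhammer_prod prod_dividef atLeast0LessThan)
  finally show ?thesis .
qed

lemma bessel_ratio_sums:
  assumes "x > 0"
  obtains S where "(\<lambda>k. bessel_ratio (Suc k) x) sums S"
    and "\<And>n. exp (- x) * bessel_I (real n) x = bessel_ratio n x / (1 + 2 * S)"
proof
  define S where "S = (exp x - bessel_I 0 x) / 2 / bessel_I 0 x"
  show S: "(\<lambda>k. bessel_ratio (Suc k) x) sums S"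
    using sums_divide[OF bessel_I_generating[OF assms], of "bessel_I 0 x"]
    by (simp add: bessel_ratio_def S_def)
  have "1 + 2 * S = exp x / bessel_I 0 x"
    using bessel_I_0_pos[OF assms] by (simp add: S_def field_simps)
  then show "exp (- x) * bessel_I (real n) x = bessel_ratio n x / (1 + 2 * S)" for n
    using bessel_I_0_pos[OF assms] by (simp add: bessel_ratio_def exp_minus field_simps)
qed

subsection \<open>Gaussian tails\<close>

text \<open>A lower bound for the Gaussian tail \<open>\<integral>\<^sub>t\<^sup>\<infinity> e\<^bsup>-au\<^sup>2\<^esup> du\<close>.\<close>
definition mills :: "real \<Rightarrow> real \<Rightarrow> real" where
  "mills a t = exp (- a * t\<^sup>2) / (a * (t + sqrt (t\<^sup>2 + 2 / a)))"

text \<open>Rationalising the denominator by (s + t) (s - t) = 2 / a gives a form that is easy to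
  differentiate.\<close>

lemma mills_eq:
  assumes "a > 0" "t \<ge> 0"
  shows "mills a t = exp (- a * t\<^sup>2) * (sqrt (t\<^sup>2 + 2 / a) - t) / 2"
proof -
  define s where "s = sqrt (t\<^sup>2 + 2 / a)"
  have s2: "s\<^sup>2 = t\<^sup>2 + 2 / a" and s: "s > 0"
    using assms by (auto simp: s_def intro!: add_nonneg_pos)
  have "a * ((t + s) * (s - t)) = 2"
    using s2 assms by (simp add: power2_eq_square algebra_simps)
  then have "(s - t) / 2 * (a * (t + s)) = 1" by (simp add: mult_ac)
  moreover have "a * (t + s) \<noteq> 0" using assms s by simp
  ultimately have "(s - t) / 2 = 1 / (a * (t + s))" by (simp add: nonzero_eq_divide_eq)
  then have "exp (- a * t\<^sup>2) * ((s - t) / 2) = exp (- a * t\<^sup>2) * (1 / (a * (t + s)))"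
    by (rule arg_cong)
  then show ?thesis unfolding mills_def s_def[symmetric] by simp
qed

lemma mills_pos: "a > 0 \<Longrightarrow> t \<ge> 0 \<Longrightarrow> mills a t > 0"
  unfolding mills_def
  by (intro divide_pos_pos mult_pos_pos add_nonneg_pos) (auto intro: add_nonneg_pos)

text \<open>With s the square root, -D equals the Gaussian times 1 - (s - t)^2 / (2 s (s + t)). So
  \<open>mills a\<close> never decreases faster than the tail integral does; as both tend to 0, it
  stays below that integral.\<close>

lemma mills_deriv:
  assumes "a > 0" "t > 0"
  obtains D where "(mills a has_real_derivative D) (at t)" and "- D \<le> exp (- a * t\<^sup>2)" "D \<le> 0"
proof -
  define s where "s = sqrt (t\<^sup>2 + 2 / a)"
  have s2: "s\<^sup>2 = t\<^sup>2 + 2 / a" and s: "s > 0" and ts: "t \<le> s"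
    using assms by (auto simp: s_def intro!: add_nonneg_pos real_le_rsqrt)
  have ne: "0 < t\<^sup>2 + 2 / a" using assms by (intro add_nonneg_pos) auto
  define E where "E = exp (- a * t\<^sup>2)"
  define D where "D = (- (2 * a * t) * E * (s - t) + (t / s - 1) * E) / 2"
  have exp_deriv: "((\<lambda>t. exp (- a * t\<^sup>2)) has_real_derivative - (2 * a * t) * E) (at t)"
    unfolding E_def by (auto intro!: derivative_eq_intros)
  have sqrt_deriv: "((\<lambda>t. sqrt (t\<^sup>2 + 2 / a)) has_real_derivative t / s) (at t)"
  proof -
    have "((\<lambda>t. t\<^sup>2 + 2 / a) has_real_derivative 2 * t) (at t)"
      using DERIV_add[OF DERIV_power[OF DERIV_ident, of 2 t] DERIV_const[of "2 / a"]] by simp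
    from DERIV_chain2[OF DERIV_real_sqrt[OF ne] this] show ?thesis
      unfolding s_def[symmetric] by (rule DERIV_cong) (use s in \<open>simp add: field_simps\<close>)
  qed
  have "((\<lambda>t. exp (- a * t\<^sup>2) * (sqrt (t\<^sup>2 + 2 / a) - t) / 2) has_real_derivative D) (at t)"
    using DERIV_cdivide[OF DERIV_mult[OF exp_deriv DERIV_diff[OF sqrt_deriv DERIV_ident]], of 2]
    unfolding D_def E_def s_def .
  then have "(mills a has_real_derivative D) (at t)"
    by (rule has_field_derivative_transform_within_open[where S = "{0<..}"])
      (use assms in \<open>auto simp: mills_eq\<close>)
  moreover have "- D \<le> E"
  proof -
    have a: "a * ((s - t) * (s + t)) = 2"
      using s2 assms by (simp add: power2_eq_square algebra_simps)
    have "a * (s - t) = 2 / (s + t)" using a s assms by (simp add: field_simps)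
    moreover have "D = - (E * (t * (a * (s - t)) + (s - t) / (2 * s)))"
      unfolding D_def using s by (simp add: field_simps)
    ultimately have "D = - (E * (2 * t / (s + t) + (s - t) / (2 * s)))" by simp
    moreover have "2 * t / (s + t) + (s - t) / (2 * s) = 1 - (s - t)\<^sup>2 / (2 * s * (s + t))"
    proof -
      have "2 * t / p = 4 * s * t / (2 * s * p) \<and> (s - t) / (2 * s) = (s - t) * p / (2 * s * p)
          \<and> 1 = 2 * s * p / (2 * s * p)" if "p > 0" for p
        using s that by simp
      then have "2 * t / (s + t) = 4 * s * t / (2 * s * (s + t))"
        "(s - t) / (2 * s) = (s - t) * (s + t) / (2 * s * (s + t))"
        "1 = 2 * s * (s + t) / (2 * s * (s + t))"
        using s assms by (metis add_pos_pos)+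
      moreover have "4 * s * t + (s - t) * (s + t) = 2 * s * (s + t) - (s - t)\<^sup>2"
        by (simp add: power2_eq_square algebra_simps)
      ultimately show ?thesis by (metis add_divide_distrib diff_divide_distrib)
    qed
    moreover have "(s - t)\<^sup>2 / (2 * s * (s + t)) \<ge> 0" using s assms by simp
    ultimately show ?thesis by (simp add: E_def)
  qed
  moreover have "D \<le> 0"
  proof -
    have 1: "(t / s - 1) * E \<le> 0" using ts s by (intro mult_nonpos_nonneg) (auto simp: E_def)
    have 2: "- (2 * a * t) * E * (s - t) \<le> 0"
      using ts assms by (intro mult_nonpos_nonneg) (auto simp: E_def)
    show ?thesis
      unfolding D_def by (rule divide_nonpos_pos[OF add_nonpos_nonpos[OF 2 1]]) simp
  qed
  ultimately show ?thesis using that by (simp add: E_def)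
qed

text \<open>By the mean value theorem, the decrease over an interval is at most its length times the
  largest value of the Gaussian on it. Lower bounds for Gaussian sums follow without any
  integral.\<close>

lemma mills_diff_le:
  assumes "a > 0" "0 < s" "s \<le> t"
  shows "mills a s - mills a t \<le> (t - s) * exp (- a * s\<^sup>2)" "mills a t \<le> mills a s"
proof -
  have "mills a s - mills a t \<le> (t - s) * exp (- a * s\<^sup>2) \<and> mills a t \<le> mills a s"
  proof (cases "s = t")
    case False
    then have st: "s < t" using assms by simp
    define D where "D u = (SOME D. (mills a has_real_derivative D) (at u)
        \<and> - D \<le> exp (- a * u\<^sup>2) \<and> D \<le> 0)" for u
    have D: "(mills a has_real_derivative D u) (at u) \<and> - D u \<le> exp (- a * u\<^sup>2) \<and> D u \<le> 0"
      if "u > 0" for u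
      unfolding D_def by (rule someI_ex) (use mills_deriv[OF assms(1) that] in blast)
    obtain z where z: "z > s" "z < t" "mills a t - mills a s = (t - s) * D z"
      using MVT2[OF st, of "mills a" D] D assms by force
    have "s\<^sup>2 \<le> z\<^sup>2" using z assms by (intro power_mono) auto
    then have "exp (- a * z\<^sup>2) \<le> exp (- a * s\<^sup>2)" using assms by simp
    moreover have "- D z \<le> exp (- a * z\<^sup>2)" "D z \<le> 0" using D[of z] z assms by auto
    ultimately have "- D z \<le> exp (- a * s\<^sup>2)" "D z \<le> 0" by linarith+
    then have "(t - s) * (- D z) \<le> (t - s) * exp (- a * s\<^sup>2)" "(t - s) * D z \<le> 0"
      using st by (simp_all only: mult_left_mono mult_nonneg_nonpos diff_ge_0_iff_ge less_imp_le)
    then show ?thesis using z by simp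
  qed simp
  then show "mills a s - mills a t \<le> (t - s) * exp (- a * s\<^sup>2)" "mills a t \<le> mills a s"
    by auto
qed

lemma mills_tendsto_0:
  assumes "a > 0"
  shows "(mills a \<longlongrightarrow> 0) at_top"
proof (rule tendsto_sandwich[of "\<lambda>_. 0" _ _ "\<lambda>t. 1 / a * (1 / t)"])
  show "\<forall>\<^sub>F t in at_top. 0 \<le> mills a t"
    using eventually_ge_at_top[of 0] by eventually_elim (use mills_pos[OF assms] in \<open>simp add: less_imp_le\<close>)
  show "\<forall>\<^sub>F t in at_top. mills a t \<le> 1 / a * (1 / t)"
    using eventually_gt_at_top[of 0]
  proof eventually_elim
    case (elim t)
    have "mills a t \<le> 1 / (a * (t + 0))"
      unfolding mills_def using assms elim
      by (intro frac_le mult_left_mono add_left_mono) auto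
    then show ?case by simp
  qed
  show "((\<lambda>t. 1 / a * (1 / t)) \<longlongrightarrow> 0) at_top" by real_asymp
qed simp

lemma gaussian_antiderivative:
  fixes a :: real
  assumes "a > 0"
  obtains E where "E 0 = 0" "\<And>t. t \<ge> 0 \<Longrightarrow> E t \<le> sqrt (pi / a) / 2"
    "\<And>t. t \<ge> 0 \<Longrightarrow> (E has_real_derivative exp (- a * t\<^sup>2)) (at t)"
proof -
  define r where "r = sqrt a"
  have r: "r > 0" "r\<^sup>2 = a" using assms by (auto simp: r_def)
  let ?f = "\<lambda>u::real. exp (- u\<^sup>2)"
  \<comment> \<open>The integrals start at -1 so that 0 is an interior point, where \<open>G\<close>
    then has a two-sided derivative.\<close>
  define G where "G t = integral {-1..t} ?f - integral {-1..0} ?f" for t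
  have cont: "continuous_on A ?f" for A
    by (intro continuous_intros)
  have int: "?f integrable_on {s..t}" for s t
    by (intro integrable_continuous_interval cont)
  have total: "(?f has_integral sqrt pi / 2) {0..}"
  proof -
    have "((\<lambda>u::real. indicator {0..} u *\<^sub>R ?f u) has_integral sqrt pi / 2) UNIV"
      using has_integral_integral_lborel gaussian_moment_0
      by (metis (no_types, lifting) has_bochner_integral_iff)
    also have "(\<lambda>u::real. indicator {0..} u *\<^sub>R ?f u) = (\<lambda>u. if u \<in> {0..} then ?f u else 0)"
      by (auto simp: indicator_def)
    finally show ?thesis by (subst (asm) has_integral_restrict_UNIV)
  qed
  have G_le: "G t \<le> sqrt pi / 2" if "t \<ge> 0" for t
  proof -
    have "G t = integral {0..t} ?f"
      using Henstock_Kurzweil_Integration.integral_combine[of "-1" 0 t ?f] int that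
      by (simp add: G_def)
    also have "\<dots> \<le> sqrt pi / 2"
      by (rule has_integral_subset_le[OF _ integrable_integral[OF int] total]) auto
    finally show ?thesis .
  qed
  have G_deriv: "(G has_real_derivative exp (- t\<^sup>2)) (at t)" if "t \<ge> 0" for t
  proof -
    have "((\<lambda>t. integral {-1..t} ?f) has_real_derivative ?f t) (at t within {-1..t + 1})"
      using that by (intro integral_has_real_derivative cont) auto
    moreover have "at t within {-1..t + 1} = at t"
      by (rule at_within_interior) (use that in auto)
    ultimately show ?thesis
      unfolding G_def by (auto intro!: derivative_eq_intros)
  qed
  show ?thesis
  proof (rule that[of "\<lambda>t. G (r * t) / r"])
    show "G (r * 0) / r = 0" by (simp add: G_def)
    fix t :: real assume t: "t \<ge> 0"
    have "G (r * t) / r \<le> sqrt pi / 2 / r" using r t by (intro divide_right_mono G_le) auto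
    then show "G (r * t) / r \<le> sqrt (pi / a) / 2" by (simp add: r_def real_sqrt_divide)
    have "(G has_real_derivative exp (- (r * t)\<^sup>2)) (at (r * t))"
      using t r by (intro G_deriv) auto
    then have "((\<lambda>t. G (r * t)) has_real_derivative exp (- (r * t)\<^sup>2) * r) (at t)"
      by (rule DERIV_chain2) (auto intro!: derivative_eq_intros)
    then have "((\<lambda>t. G (r * t) / r) has_real_derivative exp (- (r * t)\<^sup>2) * r / r) (at t)"
      by (rule DERIV_cdivide)
    then show "((\<lambda>t. G (r * t) / r) has_real_derivative exp (- a * t\<^sup>2)) (at t)"
      using r by (simp add: power_mult_distrib)
  qed
qed

text \<open>Each term is at most the integral over the unit interval to its left, so the sum is at
  most \<open>E y\<close>. The sum \<open>E\<close> + \<open>mills a\<close> is nondecreasing and,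
  at infinity, bounded by the half-line integral; hence \<open>mills a y\<close> can be subtracted.
  A real endpoint y is allowed because \<open>U0\<close> takes its tail at x itself.\<close>

lemma sum_gaussian_le:
  assumes "a > 0" "real N \<le> y" "y > 0"
  shows "(\<Sum>k<N. exp (- a * (real (Suc k))\<^sup>2)) \<le> sqrt (pi / a) / 2 - mills a y"
proof -
  obtain E where E: "E 0 = 0" "\<And>t. t \<ge> 0 \<Longrightarrow> E t \<le> sqrt (pi / a) / 2"
    "\<And>t. t \<ge> 0 \<Longrightarrow> (E has_real_derivative exp (- a * t\<^sup>2)) (at t)"
    using gaussian_antiderivative[OF assms(1)] by blast
  have E_mono: "(t - s) * exp (- a * t\<^sup>2) \<le> E t - E s" if st: "0 \<le> s" "s < t" for s t
  proof -
    obtain z where z: "s < z" "z < t" "E t - E s = (t - s) * exp (- a * z\<^sup>2)"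
      using MVT2[OF st(2), of E "\<lambda>t. exp (- a * t\<^sup>2)"] E(3) st by force
    then have "z\<^sup>2 \<le> t\<^sup>2" using st by (intro power_mono) auto
    then have "exp (- a * z\<^sup>2) \<ge> exp (- a * t\<^sup>2)" using assms by simp
    then show ?thesis using z st by (simp add: mult_left_mono)
  qed
  have "(\<Sum>k<N. exp (- a * (real (Suc k))\<^sup>2)) \<le> E (real N)"
  proof (induction N)
    case (Suc N)
    then show ?case using E_mono[of "real N" "real (Suc N)"] by simp
  qed (simp add: E)
  also have "E (real N) \<le> E y"
  proof (cases "real N = y")
    case False
    moreover have "(y - real N) * exp (- a * y\<^sup>2) \<ge> 0" using assms by simp
    ultimately show ?thesis using E_mono[of "real N" y] assms by linarith
  qed simp
  also have "E y \<le> sqrt (pi / a) / 2 - mills a y"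
  proof -
    have mono: "E y + mills a y \<le> E T + mills a T" if "T \<ge> y" for T
    proof (rule DERIV_nonneg_imp_nondecreasing[OF that])
      fix t assume "y \<le> t" "t \<le> T"
      then have t: "t > 0" using assms by simp
      obtain D where "(mills a has_real_derivative D) (at t)" "- D \<le> exp (- a * t\<^sup>2)"
        using mills_deriv[OF assms(1) t] by blast
      then show "\<exists>d. ((\<lambda>t. E t + mills a t) has_real_derivative d) (at t) \<and> 0 \<le> d"
        using E(3)[of t] t by (intro exI[of _ "exp (- a * t\<^sup>2) + D"]) (auto intro: DERIV_add)
    qed
    have "E y + mills a y \<le> sqrt (pi / a) / 2 + 0"
    proof (rule tendsto_lowerbound[of "\<lambda>T. sqrt (pi / a) / 2 + mills a T" _ at_top])
      show "((\<lambda>T. sqrt (pi / a) / 2 + mills a T) \<longlongrightarrow> sqrt (pi / a) / 2 + 0) at_top"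
        by (intro tendsto_intros mills_tendsto_0 assms)
      show "\<forall>\<^sub>F T in at_top. E y + mills a y \<le> sqrt (pi / a) / 2 + mills a T"
        using eventually_ge_at_top[of y]
      proof eventually_elim
        case (elim T)
        then show ?case using mono[of T] E(2)[of T] assms by linarith
      qed
    qed simp
    then show ?thesis by simp
  qed
  finally show ?thesis .
qed

section \<open>The upper estimate of the sum\<close>

lemma bessel_ratio_tail_upper:
  assumes x: "x > 0" and S: "(\<lambda>k. bessel_ratio (Suc (m + k)) x) sums S"
  shows "S \<le> bessel_ratio m x * (F (real m + 1 / 2) x / (1 - F (real m + 3 / 2) x))"
proof -
  let ?p = "bessel_ratio m x * F (real m + 1 / 2) x" and ?r = "F (real m + 3 / 2) x"
  have r: "0 \<le> ?r" "?r < 1"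
    using F_pos[OF x, of "real m + 3 / 2"] F_less_1[OF x, of "real m + 3 / 2"] by auto
  \<comment> \<open>Only the first quotient keeps its own bound. All later ones are at most
    \<open>?r\<close> because \<open>F\<close> decreases in its first argument, so a geometric
    series dominates.\<close>
  have "bessel_ratio (Suc (m + k)) x \<le> ?p * ?r ^ k" for k
  proof (induction k)
    case 0
    then show ?case using bessel_ratio_Suc_upper[OF x, of m] by simp
  next
    case (Suc k)
    have "bessel_ratio (Suc (m + Suc k)) x
        \<le> bessel_ratio (Suc (m + k)) x * F (real (Suc (m + k)) + 1 / 2) x"
      using bessel_ratio_Suc_upper[OF x, of "Suc (m + k)"] by simp
    also have "\<dots> \<le> (?p * ?r ^ k) * ?r"
      using Suc r bessel_ratio_pos[OF x, of m] F_pos[OF x, of "real m + 1 / 2"]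
        F_pos[OF x, of "real (Suc (m + k)) + 1 / 2"]
      by (intro mult_mono F_antimono[OF x]) auto
    finally show ?case by (simp add: ac_simps)
  qed
  moreover have "(\<lambda>k. ?p * ?r ^ k) sums (?p * (1 / (1 - ?r)))"
    using r by (intro sums_mult geometric_sums) auto
  ultimately have "S \<le> ?p * (1 / (1 - ?r))" by (rule sums_le[OF _ S])
  then show ?thesis by simp
qed

text \<open>For x \<ge> 2 the first [x] - 1 terms are compared with a Gaussian sum of rate
  \<open>alpha0\<close> / (2x), and the others with the geometric tail. For x < 2 the geometric tail
  from index 0 is already \<open>U0\<close>.\<close>

lemma bessel_ratio_sum_le_U0:
  assumes x: "x > 0" and S: "(\<lambda>k. bessel_ratio (Suc k) x) sums S"
  shows "S \<le> U0 x"
proof (cases "\<lfloor>x\<rfloor> \<ge> 2")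
  case False
  then show ?thesis
    using bessel_ratio_tail_upper[OF x, of 0] S bessel_I_0_pos[OF x]
    by (simp add: U0_def bessel_ratio_def)
next
  case True
  \<comment> \<open>Taking m = [x] - 1 makes m + 1/2 and m + 3/2 the arguments [x] - 1/2 and [x] +
    1/2 of \<open>U0\<close>.\<close>
  obtain m where m: "\<lfloor>x\<rfloor> = int (Suc m)"
    using True by (metis int_ops(4) nonneg_int_cases not0_implies_Suc not_numeral_le_zero order_trans zero_le_numeral of_nat_0)
  have m_le: "real m + 1 \<le> x" using m by linarith
  define a where "a = alpha0 / (2 * x)"
  have a: "a > 0" using x alpha0_pos by (simp add: a_def)
  have head: "(\<Sum>k<m. bessel_ratio (Suc k) x) \<le> sqrt (pi / a) / 2 - mills a x"
  proof -
    have "(\<Sum>k<m. bessel_ratio (Suc k) x) \<le> (\<Sum>k<m. exp (- a * (real (Suc k))\<^sup>2))"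
      unfolding a_def using m_le by (intro sum_mono bessel_ratio_upper_exp x) auto
    also have "\<dots> \<le> sqrt (pi / a) / 2 - mills a x"
      using m_le a x by (intro sum_gaussian_le) auto
    finally show ?thesis .
  qed
  have head_eq: "sqrt (pi / a) / 2 - mills a x = 2 * x / alpha0 *
      (1 / sqrt (8 * x / (pi * alpha0)) - exp (- (alpha0 * x / 2)) / (x + sqrt (x\<^sup>2 + 4 * x / alpha0)))"
  proof -
    have inv: "2 * x / alpha0 = 1 / a" using x alpha0_pos by (simp add: a_def)
    have "8 * x / (pi * alpha0) = (2 / (a * sqrt (pi / a)))\<^sup>2"
      using x alpha0_pos a by (simp add: a_def power_divide power_mult_distrib field_simps power2_eq_square)
    moreover have "2 / (a * sqrt (pi / a)) > 0" using a by simp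
    ultimately have "sqrt (8 * x / (pi * alpha0)) = 2 / (a * sqrt (pi / a))"
      by (simp add: real_sqrt_unique)
    then have "sqrt (pi / a) / 2 = 1 / a * (1 / sqrt (8 * x / (pi * alpha0)))"
      using a by simp
    moreover have "2 / a = 4 * x / alpha0" "a * x\<^sup>2 = alpha0 * x / 2"
      using x alpha0_pos by (auto simp: a_def power2_eq_square)
    then have "mills a x = 1 / a * (exp (- (alpha0 * x / 2)) / (x + sqrt (x\<^sup>2 + 4 * x / alpha0)))"
      unfolding mills_def by simp
    ultimately show ?thesis unfolding inv by (simp only: right_diff_distrib)
  qed
  have "(\<lambda>k. bessel_ratio (Suc (m + k)) x) sums (S - (\<Sum>k<m. bessel_ratio (Suc k) x))"
    using sums_split_initial_segment[OF S, of m] by (simp add: add.commute)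
  then have "S - (\<Sum>k<m. bessel_ratio (Suc k) x)
      \<le> bessel_ratio m x * (F (real m + 1 / 2) x / (1 - F (real m + 3 / 2) x))"
    by (rule bessel_ratio_tail_upper[OF x])
  also have "\<dots> \<le> exp (- (alpha0 / (2 * x)) * (real m)\<^sup>2)
      * (F (real m + 1 / 2) x / (1 - F (real m + 3 / 2) x))"
    using m_le F_pos[OF x, of "real m + 1 / 2"] F_less_1[OF x, of "real m + 3 / 2"]
    by (intro mult_right_mono bessel_ratio_upper_exp x) auto
  finally have "S \<le> sqrt (pi / a) / 2 - mills a x + exp (- (alpha0 / (2 * x)) * (real m)\<^sup>2)
      * (F (real m + 1 / 2) x / (1 - F (real m + 3 / 2) x))"
    using head by linarith
  also have "\<dots> = U0 x"
    using True unfolding head_eq U0_def Let_def m by (simp add: add.commute)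
  finally show ?thesis .
qed

section \<open>The lower estimate of the sum\<close>

lemma exp_minus_lower_rational:
  assumes "x > (1::real)"
  shows "(x - 1) / (x + 1) \<le> exp (- (2 / x))"
proof -
  define u where "u = 1 / x"
  have u: "0 \<le> u" "u < 1" using assms by (auto simp: u_def)
  \<comment> \<open>The function vanishes at 0 and its derivative is nonnegative because 1 - 2t
    \<le> exp (-2t).\<close>
  have "1 + 0 - (1 - 0) * exp (2 * 0) \<le> 1 + u - (1 - u) * exp (2 * u)"
  proof (rule DERIV_nonneg_imp_nondecreasing[OF u(1)])
    fix t :: real
    have "((\<lambda>t. 1 + t - (1 - t) * exp (2 * t)) has_real_derivative
        1 - (1 - 2 * t) * exp (2 * t)) (at t)"
      by (auto intro!: derivative_eq_intros simp: algebra_simps)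
    moreover have "(1 - 2 * t) * exp (2 * t) \<le> exp (- (2 * t)) * exp (2 * t)"
      using exp_ge_add_one_self[of "- (2 * t)"] by (intro mult_right_mono) auto
    then have "1 - (1 - 2 * t) * exp (2 * t) \<ge> 0" by (simp add: exp_minus)
    ultimately show "\<exists>d. ((\<lambda>t. 1 + t - (1 - t) * exp (2 * t)) has_real_derivative d) (at t) \<and> 0 \<le> d"
      by blast
  qed
  then have "(1 - u) * exp (2 * u) * exp (- (2 * u)) \<le> (1 + u) * exp (- (2 * u))"
    by (intro mult_right_mono) auto
  moreover have "exp (2 * u) * exp (- (2 * u)) = 1" by (simp add: exp_add[symmetric])
  ultimately have "1 - u \<le> (1 + u) * exp (- (2 * u))" by (simp add: mult.assoc)
  then have "(1 - u) / (1 + u) \<le> exp (- (2 * u))"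
    using u by (simp add: divide_le_eq mult.commute)
  moreover have "(1 - u) / (1 + u) = (x - 1) / (x + 1)"
  proof -
    have "1 - u = (x - 1) / x" "1 + u = (x + 1) / x"
      using assms by (simp_all add: u_def diff_divide_distrib add_divide_distrib)
    then show ?thesis using assms by simp
  qed
  ultimately show ?thesis by (simp add: u_def)
qed

text \<open>The bound of \<open>mills_diff_le\<close> on unit intervals telescopes. The shift 1/2
  comes from completing the square in k (k + 1).\<close>

lemma sum_shifted_gaussian_ge:
  assumes "a > 0"
  shows "mills a (real j + 1 / 2) - mills a (real (j + d) + 1 / 2)
    \<le> (\<Sum>k<d. exp (- a * (real (j + k) + 1 / 2)\<^sup>2))"
proof (induction d)
  case (Suc d)
  then show ?case
    using mills_diff_le(1)[OF assms, of "real (j + d) + 1 / 2" "real (j + Suc d) + 1 / 2"]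
    by simp
qed simp

text \<open>After division by \<open>e\<^bsup>-1/x\<^esup>\<close>, the comparison of the first term of \<open>L0\<close> with the first
  term of the sum. Comparing all terms with an integral is not enough for the bound of
  \<open>L0\<close>: its second and third summands both cover the index \<open>\<lfloor>x\<rfloor>\<close>, and the excess has to be
  absorbed by the gap at the index 1.\<close>
lemma first_term_gap:
  assumes x: "x > 1"
  shows "(sqrt (9 / 4 + 4 * x) - 3 / 2) / 2 + 1 / 5
    \<le> 1 + exp (- (2 / x)) * ((sqrt (25 / 4 + 4 * x) - 5 / 2) / 2)"
proof -
  define s1 s2 where "s1 = sqrt (9 / 4 + 4 * x)" "s2 = sqrt (25 / 4 + 4 * x)"
  have s1: "s1\<^sup>2 = 9 / 4 + 4 * x" "s1 > 0" and s2: "s2\<^sup>2 = 25 / 4 + 4 * x"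
    using x by (auto simp: s1_s2_def)
  have le: "s1 \<le> s2" by (simp add: s1_s2_def)
  have s2_ge: "s2 \<ge> 5 / 2" unfolding s1_s2_def by (rule real_le_rsqrt) (use x in \<open>simp add: power2_eq_square\<close>)
  have gap: "s2 - s1 \<ge> 2 / s2"
  proof -
    have "(s2 - s1) * (s2 + s1) = 4" using s1 s2 by (simp add: power2_eq_square algebra_simps)
    moreover have "(s2 - s1) * (s2 + s1) \<le> (s2 - s1) * (2 * s2)"
      using le by (intro mult_left_mono) auto
    ultimately show ?thesis using s2_ge by (simp add: field_simps)
  qed
  have x1: "x + 1 = (s2\<^sup>2 - 9 / 4) / 4" using s2 by simp
  have "s2\<^sup>2 \<ge> (5 / 2)\<^sup>2" using s2_ge by (intro power_mono) auto
  then have pos: "s2\<^sup>2 - 9 / 4 > 0" by (simp add: power2_eq_square)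
  \<comment> \<open>Replacing the exponential by (x - 1) / (x + 1) costs (s2 - 5/2) / (x + 1). The
    loss must not exceed 3/10 + 1 / s2: the constants of the claim leave 1 + 3/4 - 5/4 - 1/5 = 3/10,
    and \<open>gap\<close> provides 1 / s2. Cleared of denominators this is a cubic inequality in
    s2, made evident by completing the square around 5.\<close>
  have "0 \<le> s2 * (3 / 10 * (s2 - 5)\<^sup>2 + 73 / 40) - 9 / 4"
  proof -
    have "5 / 2 * (73 / 40) \<le> s2 * (3 / 10 * (s2 - 5)\<^sup>2 + 73 / 40)"
      using s2_ge by (intro mult_mono) auto
    then show ?thesis by simp
  qed
  also have "\<dots> = (3 / 10 * s2 + 1) * (s2\<^sup>2 - 9 / 4) - 4 * s2 * (s2 - 5 / 2)"
    by (simp add: power2_eq_square algebra_simps)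
  finally have "4 * s2 * (s2 - 5 / 2) / (s2 * (s2\<^sup>2 - 9 / 4))
      \<le> (3 / 10 * s2 + 1) * (s2\<^sup>2 - 9 / 4) / (s2 * (s2\<^sup>2 - 9 / 4))"
    using pos s2_ge by (intro divide_right_mono) auto
  then have key: "4 * (s2 - 5 / 2) / (s2\<^sup>2 - 9 / 4) \<le> 3 / 10 + 1 / s2"
    using pos s2_ge by (simp add: add_divide_distrib)
  have quot: "(x - 1) / (x + 1) = 1 - 2 / (x + 1)" using x by (simp add: field_simps)
  have "(x - 1) / (x + 1) * ((s2 - 5 / 2) / 2) = (s2 - 5 / 2) / 2 - (s2 - 5 / 2) / (x + 1)"
  proof -
    have "(1 - 2 / c) * (w / 2) = w / 2 - w / c" for c w :: real
      by (simp add: left_diff_distrib)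
    then show ?thesis unfolding quot .
  qed
  also have "(s2 - 5 / 2) / (x + 1) = 4 * (s2 - 5 / 2) / (s2\<^sup>2 - 9 / 4)"
    unfolding x1 by simp
  finally have "(s2 - 5 / 2) / 2 - (3 / 10 + 1 / s2) \<le> (x - 1) / (x + 1) * ((s2 - 5 / 2) / 2)"
    using key by linarith
  also have "\<dots> \<le> exp (- (2 / x)) * ((s2 - 5 / 2) / 2)"
    using s2_ge by (intro mult_right_mono exp_minus_lower_rational x) auto
  finally have "(s2 - 5 / 2) / 2 - (3 / 10 + 1 / s2) \<le> exp (- (2 / x)) * ((s2 - 5 / 2) / 2)" .
  moreover have "(s2 - s1) / 2 \<ge> 1 / s2" using gap by simp
  ultimately show ?thesis unfolding s1_s2_def[symmetric] by (simp add: diff_divide_distrib)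
qed

text \<open>The first three exponents are 5/x at x = 5/2, and 5/x and 9/x at x = 11/4, the cut
  points in \<open>first_term_bound_2\<close>. The last one yields the share 1/5 in
  \<open>gaussian_rest_le\<close>.\<close>

lemma exp_numeric_bounds:
  "(135 / 1000 :: real) \<le> exp (- 2)" "(159 / 1000 :: real) \<le> exp (- (20 / 11))"
  "(36 / 1000 :: real) \<le> exp (- (36 / 11))" "exp (- (9 / 5)) \<le> (1 / 5 :: real)"
proof -
  have e: "exp 1 \<le> (272 / 100 :: real)" using e_less_272 by simp
  have "exp 2 = (exp 1 :: real) ^ 2" by (simp add: exp_of_nat_mult[symmetric])
  also have "\<dots> \<le> (272 / 100) ^ 2" using e by (intro power_mono) auto
  finally have "inverse ((272 / 100) ^ 2) \<le> inverse (exp 2 :: real)"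
    by (intro le_imp_inverse_le) auto
  then have e2: "(1 / (272 / 100)\<^sup>2 :: real) \<le> exp (- 2)"
    by (simp add: exp_minus inverse_eq_divide)
  then show "(135 / 1000 :: real) \<le> exp (- 2)"
    by (rule order_trans[rotated]) (simp add: power2_eq_square)
  have "exp 3 = (exp 1 :: real) ^ 3" by (simp add: exp_of_nat_mult[symmetric])
  also have "\<dots> \<le> (272 / 100) ^ 3" using e by (intro power_mono) auto
  finally have "inverse ((272 / 100) ^ 3) \<le> inverse (exp 3 :: real)"
    by (intro le_imp_inverse_le) auto
  then have e3: "(1 / (272 / 100) ^ 3 :: real) \<le> exp (- 3)"
    by (simp add: exp_minus inverse_eq_divide)
  have "(1 / (272 / 100)\<^sup>2 :: real) * (1 + 2 / 11) \<le> exp (- 2) * exp (2 / 11)"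
    by (intro mult_mono e2 exp_ge_add_one_self) auto
  also have "\<dots> = exp (- (20 / 11))" by (simp add: exp_add[symmetric])
  finally show "(159 / 1000 :: real) \<le> exp (- (20 / 11))"
    by (rule order_trans[rotated]) (simp add: power2_eq_square)
  have "(1 / (272 / 100) ^ 3 :: real) * (1 + - (3 / 11)) \<le> exp (- 3) * exp (- (3 / 11))"
    by (intro mult_mono e3 exp_ge_add_one_self) auto
  also have "\<dots> = exp (- (36 / 11))" by (simp add: exp_add[symmetric])
  finally show "(36 / 1000 :: real) \<le> exp (- (36 / 11))"
    by (rule order_trans[rotated]) (simp add: power3_eq_cube)
  have "(5::real) \<le> (1 + 9 / 10 + (9 / 10)\<^sup>2 / 2)\<^sup>2" by (simp add: power2_eq_square)
  also have "\<dots> \<le> (exp (9 / 10))\<^sup>2"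
    by (intro power_mono exp_lower_Taylor_quadratic) auto
  also have "\<dots> = exp (9 / 5)" by (simp add: exp_of_nat_mult[symmetric])
  finally have "inverse (exp (9 / 5)) \<le> inverse (5 :: real)" by (intro le_imp_inverse_le) auto
  then show "exp (- (9 / 5)) \<le> (1 / 5 :: real)" by (simp add: exp_minus)
qed

text \<open>The fraction is at most 1, and the exponent exceeds 1/x by at least 9/5. The bound 1/5
  is exactly the margin supplied by \<open>first_term_gap\<close>.\<close>

lemma gaussian_rest_le:
  assumes n: "n \<ge> 4" "real n \<le> x" "x < real n + 1"
  shows "exp (- (real n * (real n + 1) / (2 * x))) * (2 * x / (real n + 1 / 2 + sqrt ((real n + 1 / 2)\<^sup>2 + 4 * x)))
    \<le> exp (- (1 / x)) / 5"
proof -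
  have n4: "real n \<ge> 4" using n(1) by simp
  have x: "x > 0" using n by simp
  have "x + 1 \<le> sqrt ((real n + 1 / 2)\<^sup>2 + 4 * x)"
  proof (rule real_le_rsqrt)
    have "(x - 1 / 2)\<^sup>2 \<le> (real n + 1 / 2)\<^sup>2" using n n4 by (intro power_mono) auto
    then show "(x + 1)\<^sup>2 \<le> (real n + 1 / 2)\<^sup>2 + 4 * x"
      using n n4 by (simp add: power2_eq_square algebra_simps)
  qed
  then have ratio: "2 * x / (real n + 1 / 2 + sqrt ((real n + 1 / 2)\<^sup>2 + 4 * x)) \<le> 1"
    using n x by (simp add: divide_le_eq add_pos_pos)
  \<comment> \<open>The factor 36/10 is chosen so that n (n + 1) - 2 = 36/10 (n + 1) at n = 4, the
    smallest admissible value.\<close>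
  have "0 \<le> (real n - 4) * (real n + 7 / 5)" using n4 by simp
  also have "\<dots> = real n * real n - 13 / 5 * real n - 28 / 5" by (simp add: field_simps)
  finally have "36 / 10 * (real n + 1) \<le> real n * (real n + 1) - 2"
    by (simp add: distrib_left)
  moreover have "36 / 10 * x \<le> 36 / 10 * (real n + 1)" using n by simp
  ultimately have "36 / 10 * x \<le> real n * (real n + 1) - 2" by (rule order_trans[rotated])
  then have "36 / 10 * x / (2 * x) \<le> (real n * (real n + 1) - 2) / (2 * x)"
    using x by (intro divide_right_mono) auto
  then have "9 / 5 \<le> real n * (real n + 1) / (2 * x) - 1 / x"
    using x by (simp add: diff_divide_distrib)
  then have "exp (- (real n * (real n + 1) / (2 * x))) \<le> exp (- (1 / x)) * exp (- (9 / 5))"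
    unfolding exp_add[symmetric] by simp
  also have "\<dots> \<le> exp (- (1 / x)) * (1 / 5)"
    using exp_numeric_bounds by (intro mult_left_mono) auto
  finally have "exp (- (real n * (real n + 1) / (2 * x))) \<le> exp (- (1 / x)) * (1 / 5)" .
  then have "exp (- (real n * (real n + 1) / (2 * x)))
      * (2 * x / (real n + 1 / 2 + sqrt ((real n + 1 / 2)\<^sup>2 + 4 * x))) \<le> exp (- (1 / x)) * (1 / 5) * 1"
    using ratio x by (intro mult_mono) auto
  then show ?thesis by simp
qed

text \<open>The margin is small near \<open>x = 3\<close>.\<close>
lemma first_term_bound_2:
  assumes x: "2 \<le> x" "x < 3"
  shows "(sqrt (9 / 4 + 4 * x) - 3 / 2) / 2
    \<le> 1 + exp (- (9 / x)) + exp (- (5 / x)) * (2 * x / (7 / 2 + sqrt (49 / 4 + 8 * x / pi)))"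
proof -
  define R where "R = 2 * x / (7 / 2 + sqrt (49 / 4 + 8 * x / pi))"
  \<comment> \<open>From x < 3 < \<pi> the radicand is below 49/4 + 8 = (9/2)^2, so the denominator
    is at most 8.\<close>
  have R: "R \<ge> x / 4"
  proof -
    have "8 * x / pi \<le> 8" using x pi_gt3 by (simp add: divide_le_eq)
    then have "sqrt (49 / 4 + 8 * x / pi) \<le> 9 / 2"
      by (intro real_le_lsqrt) (use x in \<open>auto simp: power2_eq_square\<close>)
    moreover have "sqrt (49 / 4 + 8 * x / pi) \<ge> 0" using x by simp
    ultimately have "2 * x / 8 \<le> R"
      unfolding R_def using x by (intro divide_left_mono mult_pos_pos add_pos_nonneg) auto
    then show ?thesis by simp
  qed
  have sq: "sqrt (9 / 4 + 4 * x) \<le> b" if "9 / 4 + 4 * x \<le> b\<^sup>2" "b \<ge> 0" for b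
    using that x by (intro real_le_lsqrt) auto
  \<comment> \<open>On each piece the square root is bounded by its value at the right end. On the
    last two pieces the exponentials and \<open>R\<close> are bounded by their values at the left
    end; on the first piece the summand 1 alone is enough.\<close>
  consider "x \<le> 5 / 2" | "5 / 2 \<le> x" "x \<le> 11 / 4" | "11 / 4 \<le> x" by linarith
  then show ?thesis
  proof cases
    case 1
    then have "sqrt (9 / 4 + 4 * x) \<le> 7 / 2" by (intro sq) (auto simp: power2_eq_square)
    then have "(sqrt (9 / 4 + 4 * x) - 3 / 2) / 2 \<le> 1" by simp
    also have "1 \<le> 1 + exp (- (9 / x)) + exp (- (5 / x)) * R" using R x by simp
    finally show ?thesis unfolding R_def .
  next
    case 2
    then have s: "sqrt (9 / 4 + 4 * x) \<le> 3641 / 1000" by (intro sq) (auto simp: power2_eq_square)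
    have "- 2 \<le> - (5 / x)" using 2 by (simp add: divide_le_eq)
    then have "135 / 1000 \<le> exp (- (5 / x))"
      using exp_numeric_bounds(1) by (meson exp_le_cancel_iff order_trans)
    then have "135 / 1000 * (5 / 8) \<le> exp (- (5 / x)) * R"
      using R 2 by (intro mult_mono) auto
    then have "8 / 100 \<le> exp (- (5 / x)) * R" by simp
    moreover have "(sqrt (9 / 4 + 4 * x) - 3 / 2) / 2 \<le> 1 + 0 + 8 / 100" using s by simp
    moreover have "0 \<le> exp (- (9 / x))" by simp
    ultimately show ?thesis unfolding R_def[symmetric] by (meson add_mono order_refl order_trans)
  next
    case 3
    then have s: "sqrt (9 / 4 + 4 * x) \<le> 3775 / 1000"
      using x by (intro sq) (auto simp: power2_eq_square)
    have "- (20 / 11) \<le> - (5 / x)" "- (36 / 11) \<le> - (9 / x)" using 3 by (auto simp: divide_simps)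
    then have "159 / 1000 \<le> exp (- (5 / x))" "36 / 1000 \<le> exp (- (9 / x))"
      using exp_numeric_bounds(2,3) by (meson exp_le_cancel_iff order_trans)+
    moreover from this have "159 / 1000 * (11 / 16) \<le> exp (- (5 / x)) * R"
      using R 3 by (intro mult_mono) auto
    then have "109 / 1000 \<le> exp (- (5 / x)) * R" by simp
    moreover have "(sqrt (9 / 4 + 4 * x) - 3 / 2) / 2 \<le> 1 + 36 / 1000 + 109 / 1000" using s by simp
    ultimately show ?thesis unfolding R_def[symmetric] by (meson add_mono order_refl order_trans)
  qed
qed

text \<open>The tail of the Gaussian sum contributes through the index \<open>n + 2\<close>, which is needed
  only for \<open>n = 2\<close>.\<close>
lemma gaussian_sum_lower:
  assumes n: "n \<ge> 2" "real n \<le> x" "x < real n + 1"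
  defines "f \<equiv> \<lambda>k. exp (- (k * (k + 1) / (2 * x)))"
  shows "2 * x * exp (- (1 / x)) / (3 / 2 + sqrt (9 / 4 + 4 * x))
      - 2 * x * exp (- (1 / (2 * x)) * (real n + 1) * (real n + 2)) /
          (real n + 3 / 2 + sqrt ((real n + 3 / 2)\<^sup>2 + 8 * x / pi))
    \<le> (\<Sum>k<n - 1. f (real (Suc k))) + f (real n + 2)"
proof -
  have x: "x > 0" "x \<ge> 2" using n by auto
  define H where "H = 2 * x * exp (- (1 / (2 * x)) * (real n + 1) * (real n + 2)) /
          (real n + 3 / 2 + sqrt ((real n + 3 / 2)\<^sup>2 + 8 * x / pi))"
  have H: "H \<ge> 0" unfolding H_def using x by simp
  define q where "q = exp (- (1 / x))"
  have q: "q > 0" by (simp add: q_def)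
  define a where "a = 1 / (2 * x)"
  have a: "a > 0" "2 / a = 4 * x" using x by (auto simp: a_def)
  \<comment> \<open>Since k (k + 1) = (k + 1/2)^2 - 1/4, \<open>f\<close> is a Gaussian centred at
    -1/2 up to a constant factor. \<open>G t\<close> is the matching lower bound for the integral of
    \<open>f\<close> from t to infinity, and \<open>G 1\<close> is the first summand of
    \<open>L0\<close>.\<close>
  define G where "G t = exp (1 / (8 * x)) * mills a (t + 1 / 2)" for t
  have f_eq: "f t = exp (1 / (8 * x)) * exp (- a * (t + 1 / 2)\<^sup>2)" for t
    unfolding f_def exp_add[symmetric] a_def using x by (simp add: field_simps power2_eq_square)
  have G_div: "G t = f t * (2 * x / (t + 1 / 2 + sqrt ((t + 1 / 2)\<^sup>2 + 4 * x)))" for t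
    unfolding G_def f_eq mills_def a by (simp add: a_def)
  have G_eq: "G t = f t * ((sqrt ((t + 1 / 2)\<^sup>2 + 4 * x) - (t + 1 / 2)) / 2)" if "t \<ge> 0" for t
    unfolding G_def f_eq using mills_eq[of a "t + 1 / 2"] a that by simp
  have f1: "f 1 = q" unfolding f_def q_def by simp
  have f2: "f 2 = q * exp (- (2 / x))"
    unfolding f_def q_def exp_add[symmetric] using x by (simp add: field_simps)
  have "2 * x * exp (- (1 / x)) / (3 / 2 + sqrt (9 / 4 + 4 * x)) = G 1"
    unfolding G_div f1 q_def by (simp add: power2_eq_square)
  also have G1: "G 1 = q * ((sqrt (9 / 4 + 4 * x) - 3 / 2) / 2)"
    using G_eq[of 1] unfolding f1 by (simp add: power2_eq_square)
  finally have lhs: "2 * x * exp (- (1 / x)) / (3 / 2 + sqrt (9 / 4 + 4 * x))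
      = q * ((sqrt (9 / 4 + 4 * x) - 3 / 2) / 2)" .
  have f_pos: "f t \<ge> 0" for t by (simp add: f_def)
  \<comment> \<open>For n = 2 the sum consists of the index 1 only, so \<open>f 4\<close> and
    \<open>H\<close> must make up the difference. For n = 3 the indices 1 and 2 suffice: they give
    at least 3/2 in units of \<open>q\<close>, against at most 7/5. From n = 4 on, the indices from
    2 are telescoped and the index 1 is kept aside for its gap.\<close>
  consider "n = 2" | "n = 3" | "n \<ge> 4" using n by linarith
  then have "q * ((sqrt (9 / 4 + 4 * x) - 3 / 2) / 2)
      \<le> (\<Sum>k<n - 1. f (real (Suc k))) + f (real n + 2) + H"
  proof cases
    case 1
    have f4: "f 4 = q * exp (- (9 / x))"
      unfolding f_def q_def exp_add[symmetric] using x by (simp add: field_simps)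
    have "exp (- (1 / (2 * x)) * 3 * 4) = q * exp (- (5 / x))"
      unfolding q_def exp_add[symmetric] using x by (simp add: field_simps)
    then have H2: "H = q * (exp (- (5 / x)) * (2 * x / (7 / 2 + sqrt (49 / 4 + 8 * x / pi))))"
      unfolding H_def 1 by (simp add: power2_eq_square)
    have "q * ((sqrt (9 / 4 + 4 * x) - 3 / 2) / 2)
        \<le> q * (1 + exp (- (9 / x)) + exp (- (5 / x)) * (2 * x / (7 / 2 + sqrt (49 / 4 + 8 * x / pi))))"
      using q n 1 by (intro mult_left_mono first_term_bound_2) auto
    then show ?thesis unfolding H2 using 1 f1 f4 by (simp add: distrib_left)
  next
    case 2
    have "sqrt (9 / 4 + 4 * x) \<le> 43 / 10"
      using n 2 by (intro real_le_lsqrt) (auto simp: power2_eq_square)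
    moreover have "1 / 2 \<le> (x - 1) / (x + 1)" using n 2 by (simp add: field_simps)
    then have "1 / 2 \<le> exp (- (2 / x))" using exp_minus_lower_rational[of x] x by linarith
    ultimately have "q * ((sqrt (9 / 4 + 4 * x) - 3 / 2) / 2) \<le> q * (1 + exp (- (2 / x)))"
      using q by (intro mult_left_mono) auto
    also have "\<dots> = (\<Sum>k<n - 1. f (real (Suc k)))"
      using 2 f1 f2 by (simp add: distrib_left numeral_2_eq_2)
    finally show ?thesis using H f_pos[of "real n + 2"] by linarith
  next
    case 3
    obtain d where d: "n = 2 + d" using 3 by (metis le_Suc_ex n(1))
    have Gn: "G (real n) \<le> q / 5"
      using gaussian_rest_le[OF 3 n(2,3)] unfolding G_div f_def q_def .
    have G2: "G 2 = q * exp (- (2 / x)) * ((sqrt (25 / 4 + 4 * x) - 5 / 2) / 2)"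
      using G_eq[of 2] unfolding f2 by (simp add: power2_eq_square)
    have "G 2 - G (real n) = exp (1 / (8 * x)) *
        (mills a (real 2 + 1 / 2) - mills a (real (2 + d) + 1 / 2))"
      unfolding G_def d by (simp add: right_diff_distrib)
    also have "\<dots> \<le> exp (1 / (8 * x)) * (\<Sum>k<d. exp (- a * (real (2 + k) + 1 / 2)\<^sup>2))"
      by (intro mult_left_mono sum_shifted_gaussian_ge a) auto
    also have "\<dots> = (\<Sum>k<d. f (real (Suc (Suc k))))"
      unfolding sum_distrib_left f_eq by simp
    finally have rest: "G 2 - G (real n) \<le> (\<Sum>k<d. f (real (Suc (Suc k))))" .
    have "n - 1 = Suc d" using d by simp
    then have split: "(\<Sum>k<n - 1. f (real (Suc k))) = q + (\<Sum>k<d. f (real (Suc (Suc k))))"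
      using f1 by (simp only: sum.lessThan_Suc_shift) simp
    have "q * ((sqrt (9 / 4 + 4 * x) - 3 / 2) / 2 + 1 / 5)
        \<le> q * (1 + exp (- (2 / x)) * ((sqrt (25 / 4 + 4 * x) - 5 / 2) / 2))"
      using q x by (intro mult_left_mono first_term_gap) auto
    then have "q * ((sqrt (9 / 4 + 4 * x) - 3 / 2) / 2) + q / 5 \<le> q + G 2"
      unfolding G2 by (simp add: distrib_left)
    then show ?thesis using rest split Gn H f_pos[of "real n + 2"] by linarith
  qed
  then show ?thesis unfolding lhs H_def[symmetric] by linarith
qed

text \<open>For n = [x] \<ge> 2 the indices below n and the index n + 2 are bounded by Gaussians.
  The indices n and n + 1 are reached from n - 1 by one and two factors \<open>F\<close>, which is
  the third summand of \<open>L0\<close>. For [x] < 2 the first two terms suffice.\<close>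

lemma L0_le_bessel_ratio_sum:
  assumes x: "x > 0" and S: "(\<lambda>k. bessel_ratio (Suc k) x) sums S"
  shows "L0 x \<le> S"
proof (cases "\<lfloor>x\<rfloor> \<ge> 2")
  case False
  have r1: "F 1 x \<le> bessel_ratio 1 x"
    using bessel_ratio_Suc_lower[OF x, of 0] bessel_I_0_pos[OF x] by (simp add: bessel_ratio_def)
  have "F 1 x * F 2 x \<le> bessel_ratio 1 x * F 2 x"
    using r1 F_pos[OF x, of 2] by (intro mult_right_mono) auto
  also have "\<dots> \<le> bessel_ratio 2 x"
    using bessel_ratio_Suc_lower[OF x, of 1] by (simp add: numeral_2_eq_2)
  finally have "L0 x \<le> (\<Sum>k<2. bessel_ratio (Suc k) x)"
    using False r1 by (simp add: L0_def numeral_2_eq_2 distrib_left)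
  also have "\<dots> \<le> S"
    using sum_le_suminf[of "\<lambda>k. bessel_ratio (Suc k) x" "{..<2}"] S bessel_ratio_pos[OF x]
    by (auto simp: sums_iff less_imp_le)
  finally show ?thesis .
next
  case True
  define n where "n = nat \<lfloor>x\<rfloor>"
  have n: "real_of_int \<lfloor>x\<rfloor> = real n" "n \<ge> 2" "real n \<le> x" "x < real n + 1"
    using True unfolding n_def by linarith+
  let ?f = "\<lambda>k. exp (- (k * (k + 1) / (2 * x)))"
  define e where "e = exp (- ((real n - 1) * real n / (2 * x)))"
  have e: "e \<ge> 0" by (simp add: e_def)
  have Fn: "F (real n) x \<ge> 0" "F (real n + 1) x \<ge> 0"
    using F_pos[OF x, of "real n"] F_pos[OF x, of "real n + 1"] by auto
  have "e \<le> bessel_ratio (n - 1) x"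
    using bessel_ratio_lower_exp[OF x, of "n - 1"] n(2) by (simp add: e_def of_nat_diff)
  then have "e * F (real n) x \<le> bessel_ratio (n - 1) x * F (real n) x"
    using Fn by (intro mult_right_mono)
  also have "\<dots> \<le> bessel_ratio n x"
    using bessel_ratio_Suc_lower[OF x, of "n - 1"] n(2) by (simp add: of_nat_diff)
  finally have rn: "e * F (real n) x \<le> bessel_ratio n x" .
  then have "e * F (real n) x * F (real n + 1) x \<le> bessel_ratio n x * F (real n + 1) x"
    using Fn by (intro mult_right_mono)
  also have "\<dots> \<le> bessel_ratio (Suc n) x" by (rule bessel_ratio_Suc_lower[OF x])
  finally have rSn: "e * F (real n) x * F (real n + 1) x \<le> bessel_ratio (Suc n) x" .
  have head: "(\<Sum>k<n - 1. ?f (real (Suc k))) \<le> (\<Sum>k<n - 1. bessel_ratio (Suc k) x)"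
    by (intro sum_mono bessel_ratio_lower_exp x)
  have tail: "?f (real n + 2) \<le> bessel_ratio (Suc (Suc n)) x"
    using bessel_ratio_lower_exp[OF x, of "Suc (Suc n)"] by (simp add: add.commute)
  obtain m where m: "n = Suc m" using n(2) by (cases n) auto
  have "L0 x \<le> (\<Sum>k<n - 1. ?f (real (Suc k))) + ?f (real n + 2)
      + e * F (real n) x * (1 + F (real n + 1) x)"
    using gaussian_sum_lower[OF n(2-4)] True unfolding L0_def Let_def n(1) e_def by simp
  also have "\<dots> \<le> (\<Sum>k<n - 1. bessel_ratio (Suc k) x) + bessel_ratio (Suc (Suc n)) x
      + (bessel_ratio n x + bessel_ratio (Suc n) x)"
    using head tail rn rSn by (simp add: distrib_left)
  also have "\<dots> = (\<Sum>k<n + 2. bessel_ratio (Suc k) x)"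
    by (simp add: m numeral_2_eq_2)
  also have "\<dots> \<le> S"
    using sum_le_suminf[of "\<lambda>k. bessel_ratio (Suc k) x" "{..<n + 2}"] S bessel_ratio_pos[OF x]
    by (auto simp: sums_iff less_imp_le)
  finally show ?thesis .
qed

text \<open>It keeps the denominator 1 + 2 \<open>L0 x\<close> positive in the upper bounds. The
  subtracted fraction has the smaller numerator and the larger denominator; the latter rests on x <
  [x] + 1 and \<pi> < 4.\<close>

lemma L0_nonneg:
  assumes x: "x > 0"
  shows "L0 x \<ge> 0"
proof (cases "\<lfloor>x\<rfloor> \<ge> 2")
  case False
  then show ?thesis using F_pos[OF x, of 1] F_pos[OF x, of 2] by (simp add: L0_def)
next
  case True
  define n where "n = real_of_int \<lfloor>x\<rfloor>"
  have n: "n \<ge> 2" "x < n + 1" using True unfolding n_def by linarith+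
  have "2 * x * exp (- (1 / (2 * x)) * (n + 1) * (n + 2)) / (n + 3 / 2 + sqrt ((n + 3 / 2)\<^sup>2 + 8 * x / pi))
      \<le> 2 * x * exp (- (1 / x)) / (3 / 2 + sqrt (9 / 4 + 4 * x))"
  proof (rule frac_le)
    have "2 \<le> (n + 1) * (n + 2)" using n mult_mono[of 1 "n + 1" 2 "n + 2"] by simp
    then have "1 / (2 * x) * 2 \<le> 1 / (2 * x) * ((n + 1) * (n + 2))"
      using x by (intro mult_left_mono) auto
    then show "2 * x * exp (- (1 / (2 * x)) * (n + 1) * (n + 2)) \<le> 2 * x * exp (- (1 / x))"
      using x by (simp add: mult.assoc)
    have "2 * x \<le> 8 * x / pi" using x pi_less_4 by (simp add: le_divide_eq)
    moreover have "2 * (n + 1) \<le> n * n + 3 * n" using n mult_mono[of 2 n 2 n] by simp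
    ultimately have "9 / 4 + 4 * x \<le> (n + 3 / 2)\<^sup>2 + 8 * x / pi"
      using n by (simp add: power2_eq_square algebra_simps)
    then show "3 / 2 + sqrt (9 / 4 + 4 * x) \<le> n + 3 / 2 + sqrt ((n + 3 / 2)\<^sup>2 + 8 * x / pi)"
      using n by (intro add_mono[OF _ real_sqrt_le_mono]) auto
    show "0 < 3 / 2 + sqrt (9 / 4 + 4 * x)" using x by (intro add_pos_nonneg) auto
  qed (use x in auto)
  moreover have "0 \<le> exp (- ((n - 1) * n / (2 * x))) * F n x * (1 + F (n + 1) x)"
    using F_pos[OF x, of n] F_pos[OF x, of "n + 1"] n by simp
  ultimately show ?thesis using True unfolding L0_def Let_def n_def[symmetric] by simp
qed

section \<open>From normalised quotients to the two-sided bounds\<close>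

theorem theorem2:
  fixes \<nu> :: nat and x :: real
  assumes "x > 0"
  shows
    "(real \<nu> \<le> x \<longrightarrow>
        exp (- (real \<nu> * (real \<nu> + 1) / (2 * x))) / (1 + 2 * U0 x)
          \<le> exp (- x) * bessel_I (real \<nu>) x \<and>
        exp (- x) * bessel_I (real \<nu>) x
          \<le> exp (- (alpha0 / (2 * x)) * (real \<nu>)\<^sup>2) / (1 + 2 * L0 x)) \<and>
     (real \<nu> > x \<longrightarrow>
        exp (- (real_of_int \<lfloor>x\<rfloor> * (real_of_int \<lfloor>x\<rfloor> + 1) / (2 * x)))
          * Beta (real_of_int \<lfloor>x\<rfloor> + x / 2 + 1) (real \<nu> - real_of_int \<lfloor>x\<rfloor>)
          * ((x / 2) powi (int \<nu> - \<lfloor>x\<rfloor>) / fact (nat (int \<nu> - \<lfloor>x\<rfloor> - 1)))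
          / (1 + 2 * U0 x)
          \<le> exp (- x) * bessel_I (real \<nu>) x \<and>
        exp (- x) * bessel_I (real \<nu>) x
          \<le> exp (- (alpha0 / (2 * x)) * (real_of_int \<lfloor>x\<rfloor>)\<^sup>2)
              * Beta (real_of_int \<lfloor>x\<rfloor> + x + 1 / 2) (real \<nu> - real_of_int \<lfloor>x\<rfloor>)
              * (x powi (int \<nu> - \<lfloor>x\<rfloor>) / fact (nat (int \<nu> - \<lfloor>x\<rfloor> - 1)))
              / (1 + 2 * L0 x))"
proof -
  obtain S where S: "(\<lambda>k. bessel_ratio (Suc k) x) sums S"
    and eq: "exp (- x) * bessel_I (real n) x = bessel_ratio n x / (1 + 2 * S)" for n
    using bessel_ratio_sums[OF assms] by metis
  have bounds: "0 \<le> L0 x" "L0 x \<le> S" "S \<le> U0 x"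
    using L0_nonneg L0_le_bessel_ratio_sum bessel_ratio_sum_le_U0 S assms by blast+
  have transfer: "l / (1 + 2 * U0 x) \<le> exp (- x) * bessel_I (real n) x \<and>
      exp (- x) * bessel_I (real n) x \<le> u / (1 + 2 * L0 x)"
    if "0 \<le> l" "l \<le> bessel_ratio n x" "bessel_ratio n x \<le> u" for l u n
    unfolding eq using that bounds by (intro conjI frac_le) auto
  show ?thesis
  proof (intro conjI[of "_ \<longrightarrow> _" "_ \<longrightarrow> _"] impI)
    assume "real \<nu> \<le> x"
    then show "exp (- (real \<nu> * (real \<nu> + 1) / (2 * x))) / (1 + 2 * U0 x)
          \<le> exp (- x) * bessel_I (real \<nu>) x \<and>
        exp (- x) * bessel_I (real \<nu>) x
          \<le> exp (- (alpha0 / (2 * x)) * (real \<nu>)\<^sup>2) / (1 + 2 * L0 x)"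
      using assms by (intro transfer bessel_ratio_lower_exp bessel_ratio_upper_exp) auto
  next
    assume less: "real \<nu> > x"
    define n where "n = nat \<lfloor>x\<rfloor>"
    have n: "\<lfloor>x\<rfloor> = int n" "real n \<le> x" using assms unfolding n_def by (auto simp: le_floor_iff)
    then have "n < \<nu>" using less by simp
    define d where "d = \<nu> - n"
    have d: "\<nu> = n + d" "d \<ge> 1" using \<open>n < \<nu>\<close> by (auto simp: d_def)
    have simps: "real_of_int \<lfloor>x\<rfloor> = real n" "real \<nu> - real n = real d"
      "int \<nu> - \<lfloor>x\<rfloor> = int d" "nat (int d - 1) = d - 1"
      using n d by auto
    have lower: "exp (- (real n * (real n + 1) / (2 * x))) *
        (\<Prod>j<d. x / 2 / (real n + x / 2 + 1 + real j)) \<le> bessel_ratio \<nu> x"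
    proof -
      \<comment> \<open>With k = n + j + 1, the estimate sqrt (k^2 + x^2) \<le> k + x gives x / (2k
        + x). Halving numerator and denominator yields unit steps in j, as the Beta product
        requires.\<close>
      have le: "x / 2 / (real n + x / 2 + 1 + real j) \<le> F (real (n + j + 1)) x" for j
      proof -
        define k where "k = real (n + j + 1)"
        have "sqrt (k\<^sup>2 + x\<^sup>2) \<le> k + x"
          using assms by (intro real_le_lsqrt) (auto simp: k_def power2_eq_square algebra_simps)
        moreover have "k + sqrt (k\<^sup>2 + x\<^sup>2) > 0" by (intro add_pos_nonneg) (auto simp: k_def)
        ultimately have "x / (2 * (k + x / 2)) \<le> F k x"
          unfolding F_def using assms by (intro divide_left_mono) (auto simp: k_def)
        then show ?thesis by (simp add: k_def add_ac)
      qed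
      have "(\<Prod>j<d. x / 2 / (real n + x / 2 + 1 + real j)) \<le> (\<Prod>j<d. F (real (n + j + 1)) x)"
        using assms le by (intro prod_mono) auto
      then have "exp (- (real n * (real n + 1) / (2 * x))) *
          (\<Prod>j<d. x / 2 / (real n + x / 2 + 1 + real j))
          \<le> bessel_ratio n x * (\<Prod>j<d. F (real (n + j + 1)) x)"
        using assms bessel_ratio_pos[OF assms, of n]
        by (intro mult_mono bessel_ratio_lower_exp prod_nonneg) auto
      also have "\<dots> \<le> bessel_ratio \<nu> x"
        using divide_right_mono[OF bessel_I_prod_lower[OF assms, of n d], of "bessel_I 0 x"]
          bessel_I_0_pos[OF assms] by (simp add: bessel_ratio_def d)
      finally show ?thesis .
    qed
    have upper: "bessel_ratio \<nu> x \<le> exp (- (alpha0 / (2 * x)) * (real n)\<^sup>2) *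
        (\<Prod>j<d. x / (real n + x + 1 / 2 + real j))"
    proof -
      \<comment> \<open>Here sqrt (t^2 + x^2) \<ge> x is enough, and the denominator t + x already
        moves in unit steps.\<close>
      have le: "F (real (n + j) + 1 / 2) x \<le> x / (real n + x + 1 / 2 + real j)" for j
      proof -
        define t where "t = real (n + j) + 1 / 2"
        have "x \<le> sqrt (t\<^sup>2 + x\<^sup>2)" by (intro real_le_rsqrt) auto
        then have "F t x \<le> x / (t + x)"
          unfolding F_def using assms
          by (intro divide_left_mono mult_pos_pos add_pos_nonneg) (auto simp: t_def)
        then show ?thesis by (simp add: t_def add_ac)
      qed
      have F_nonneg: "0 \<le> F (real n + real j + 1 / 2) x" for j
        using F_pos[OF assms, of "real n + real j + 1 / 2"] by simp
      have "bessel_ratio \<nu> x \<le> bessel_ratio n x * (\<Prod>j<d. F (real (n + j) + 1 / 2) x)"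
        using divide_right_mono[OF bessel_I_prod_upper[OF assms, of n d], of "bessel_I 0 x"]
          bessel_I_0_pos[OF assms] by (simp add: bessel_ratio_def d)
      also have "\<dots> \<le> exp (- (alpha0 / (2 * x)) * (real n)\<^sup>2) *
          (\<Prod>j<d. x / (real n + x + 1 / 2 + real j))"
        using assms le n(2) F_nonneg
        by (intro mult_mono bessel_ratio_upper_exp prod_mono prod_nonneg conjI ballI) auto
      finally show ?thesis .
    qed
    have beta: "c * Beta y (real d) * (z ^ d / fact (d - 1)) = c * (\<Prod>j<d. z / (y + real j))"
      if "y > 0" for c y z :: real
      using Beta_power_eq_prod[OF that d(2), of z] by (simp only: mult.assoc)
    show "exp (- (real_of_int \<lfloor>x\<rfloor> * (real_of_int \<lfloor>x\<rfloor> + 1) / (2 * x)))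
          * Beta (real_of_int \<lfloor>x\<rfloor> + x / 2 + 1) (real \<nu> - real_of_int \<lfloor>x\<rfloor>)
          * ((x / 2) powi (int \<nu> - \<lfloor>x\<rfloor>) / fact (nat (int \<nu> - \<lfloor>x\<rfloor> - 1)))
          / (1 + 2 * U0 x)
          \<le> exp (- x) * bessel_I (real \<nu>) x \<and>
        exp (- x) * bessel_I (real \<nu>) x
          \<le> exp (- (alpha0 / (2 * x)) * (real_of_int \<lfloor>x\<rfloor>)\<^sup>2)
              * Beta (real_of_int \<lfloor>x\<rfloor> + x + 1 / 2) (real \<nu> - real_of_int \<lfloor>x\<rfloor>)
              * (x powi (int \<nu> - \<lfloor>x\<rfloor>) / fact (nat (int \<nu> - \<lfloor>x\<rfloor> - 1)))
              / (1 + 2 * L0 x)"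
      unfolding simps power_int_of_nat
    proof (subst (1 2) beta)
      show "0 < real n + x / 2 + 1" "0 < real n + x + 1 / 2" using assms by auto
      show "exp (- (real n * (real n + 1) / (2 * x))) * (\<Prod>j<d. x / 2 / (real n + x / 2 + 1 + real j))
          / (1 + 2 * U0 x) \<le> exp (- x) * bessel_I (real \<nu>) x \<and>
        exp (- x) * bessel_I (real \<nu>) x \<le> exp (- (alpha0 / (2 * x)) * (real n)\<^sup>2) *
          (\<Prod>j<d. x / (real n + x + 1 / 2 + real j)) / (1 + 2 * L0 x)"
        using assms by (intro transfer lower upper mult_nonneg_nonneg prod_nonneg) auto
    qed
  qed
qed

end
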